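(* Let $n\ge1$ and $\ell\ge2$ be integers. Let $\Lambda=\sum_{i=0}^n m_i\Lambda_i^{(n)}$ with $m_i\in\mathbb Z_{\ge0}$ and $\sum_{i=0}^n m_i=\ell$, a dominant integral weight of level $\ell$ of $A_n^{(1)}$, and let $$\Lambda'=\sum_{i=0}^n\Lambda^{(\ell-1)}_{m_i+m_{i+1}+\cdots+m_n},$$ a dominant integral weight of level $n+1$ of $A_{\ell-1}^{(1)}$. Then $$\left|\max{}^+_{A_n^{(1)}}(\Lambda)\right|=\left|\max{}^+_{A_{\ell-1}^{(1)}}(\Lambda')\right| .$$
   Context: $\Lambda_i^{(r)}$ denotes the $i$-th fundamental weight of $A_r^{(1)}$, the index $i$ being read modulo $r+1$. For an affine Kac--Moody algebra $\mathfrak g$ with null root $\delta$ and a dominant integral weight $\Lambda$, a weight $\mu$ of the irreducible highest weight module $V(\Lambda)$ is maximal if $\mu+\delta$ is not a weight of $V(\Lambda)$; $\max^+_{\mathfrak g}(\Lambda)$ is the set of maximal weights of $V(\Lambda)$ that are dominant integral. *)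

theory Defs
  imports Complex_Main "HOL-Library.Equipollence"
begin

section \<open>Lie algebras, presentations and modules over the complex numbers\<close>

locale lie_algebra = vector_space scale
  for scale :: "complex \<Rightarrow> 'g::ab_group_add \<Rightarrow> 'g" +
  fixes bracket :: "'g \<Rightarrow> 'g \<Rightarrow> 'g"
  assumes bracket_add_left: "bracket (x + y) z = bracket x z + bracket y z"
    and bracket_add_right: "bracket x (y + z) = bracket x y + bracket x z"
    and bracket_scale_left: "bracket (scale c x) y = scale c (bracket x y)"
    and bracket_scale_right: "bracket x (scale c y) = scale c (bracket x y)"
    and bracket_self: "bracket x x = 0"
    and jacobi:
      "bracket x (bracket y z) + bracket y (bracket z x) + bracket z (bracket x y) = 0"

datatype 'x lie_term =
    LGen 'x
  | LZero
  | LAdd "'x lie_term" "'x lie_term"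
  | LScale complex "'x lie_term"
  | LBracket "'x lie_term" "'x lie_term"

primrec lie_eval ::
  "(complex \<Rightarrow> 'g::ab_group_add \<Rightarrow> 'g) \<Rightarrow> ('g \<Rightarrow> 'g \<Rightarrow> 'g) \<Rightarrow> ('x \<Rightarrow> 'g) \<Rightarrow> 'x lie_term \<Rightarrow> 'g"
where
  "lie_eval scale bracket gen (LGen x) = gen x"
| "lie_eval scale bracket gen LZero = 0"
| "lie_eval scale bracket gen (LAdd s t) =
     lie_eval scale bracket gen s + lie_eval scale bracket gen t"
| "lie_eval scale bracket gen (LScale c s) = scale c (lie_eval scale bracket gen s)"
| "lie_eval scale bracket gen (LBracket s t) =
     bracket (lie_eval scale bracket gen s) (lie_eval scale bracket gen t)"

text \<open>The congruence on terms generated by the relations \<open>R\<close> and the axioms of a complex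
  Lie algebra; the terms modulo \<open>lie_derivable R\<close> are the Lie algebra presented by \<open>R\<close>.\<close>

inductive lie_derivable ::
  "('x lie_term \<times> 'x lie_term) set \<Rightarrow> 'x lie_term \<Rightarrow> 'x lie_term \<Rightarrow> bool"
  for R
where
  rel: "(s, t) \<in> R \<Longrightarrow> lie_derivable R s t"
| refl: "lie_derivable R s s"
| sym: "lie_derivable R s t \<Longrightarrow> lie_derivable R t s"
| trans: "lie_derivable R s t \<Longrightarrow> lie_derivable R t u \<Longrightarrow> lie_derivable R s u"
| cong_add: "lie_derivable R s s' \<Longrightarrow> lie_derivable R t t' \<Longrightarrow>
    lie_derivable R (LAdd s t) (LAdd s' t')"
| cong_scale: "lie_derivable R s s' \<Longrightarrow> lie_derivable R (LScale c s) (LScale c s')"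
| cong_bracket: "lie_derivable R s s' \<Longrightarrow> lie_derivable R t t' \<Longrightarrow>
    lie_derivable R (LBracket s t) (LBracket s' t')"
| add_assoc: "lie_derivable R (LAdd (LAdd s t) u) (LAdd s (LAdd t u))"
| add_commute: "lie_derivable R (LAdd s t) (LAdd t s)"
| add_zero: "lie_derivable R (LAdd LZero s) s"
| add_inverse: "lie_derivable R (LAdd s (LScale (-1) s)) LZero"
| scale_add_right: "lie_derivable R (LScale c (LAdd s t)) (LAdd (LScale c s) (LScale c t))"
| scale_add_left: "lie_derivable R (LScale (c + d) s) (LAdd (LScale c s) (LScale d s))"
| scale_scale: "lie_derivable R (LScale c (LScale d s)) (LScale (c * d) s)"
| scale_one: "lie_derivable R (LScale 1 s) s"
| bracket_add_left:
    "lie_derivable R (LBracket (LAdd s t) u) (LAdd (LBracket s u) (LBracket t u))"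
| bracket_add_right:
    "lie_derivable R (LBracket s (LAdd t u)) (LAdd (LBracket s t) (LBracket s u))"
| bracket_scale_left:
    "lie_derivable R (LBracket (LScale c s) t) (LScale c (LBracket s t))"
| bracket_scale_right:
    "lie_derivable R (LBracket s (LScale c t)) (LScale c (LBracket s t))"
| bracket_self: "lie_derivable R (LBracket s s) LZero"
| jacobi: "lie_derivable R
    (LAdd (LAdd (LBracket s (LBracket t u)) (LBracket t (LBracket u s))) (LBracket u (LBracket s t)))
    LZero"

definition lie_algebra_presented_by ::
  "('x lie_term \<times> 'x lie_term) set \<Rightarrow> (complex \<Rightarrow> 'g::ab_group_add \<Rightarrow> 'g) \<Rightarrow>
   ('g \<Rightarrow> 'g \<Rightarrow> 'g) \<Rightarrow> ('x \<Rightarrow> 'g) \<Rightarrow> bool"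
where
  "lie_algebra_presented_by R scale bracket gen \<longleftrightarrow>
     lie_algebra scale bracket \<and>
     surj (lie_eval scale bracket gen) \<and>
     (\<forall>s t. lie_eval scale bracket gen s = lie_eval scale bracket gen t \<longleftrightarrow> lie_derivable R s t)"

locale lie_module =
  lie_algebra scale bracket + V: vector_space vscale
  for scale :: "complex \<Rightarrow> 'g::ab_group_add \<Rightarrow> 'g"
    and bracket :: "'g \<Rightarrow> 'g \<Rightarrow> 'g"
    and vscale :: "complex \<Rightarrow> 'v::ab_group_add \<Rightarrow> 'v" +
  fixes act :: "'g \<Rightarrow> 'v \<Rightarrow> 'v"
  assumes act_add_left: "act (x + y) v = act x v + act y v"
    and act_scale_left: "act (scale c x) v = vscale c (act x v)"
    and act_add_right: "act x (v + w) = act x v + act x w"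
    and act_scale_right: "act x (vscale c v) = vscale c (act x v)"
    and act_bracket: "act (bracket x y) v = act x (act y v) - act y (act x v)"

definition lie_submodule ::
  "(complex \<Rightarrow> 'v::ab_group_add \<Rightarrow> 'v) \<Rightarrow> ('g \<Rightarrow> 'v \<Rightarrow> 'v) \<Rightarrow> 'v set \<Rightarrow> bool"
where
  "lie_submodule vscale act S \<longleftrightarrow>
     module.subspace vscale S \<and> (\<forall>x. \<forall>v\<in>S. act x v \<in> S)"

definition irreducible_module ::
  "(complex \<Rightarrow> 'v::ab_group_add \<Rightarrow> 'v) \<Rightarrow> ('g \<Rightarrow> 'v \<Rightarrow> 'v) \<Rightarrow> bool"
where
  "irreducible_module vscale act \<longleftrightarrow>
     (\<exists>v::'v. v \<noteq> 0) \<and> (\<forall>S. lie_submodule vscale act S \<longrightarrow> S = {0} \<or> S = UNIV)"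

section \<open>The affine Kac--Moody algebra of type \<open>A_n^{(1)}\<close>\<close>

text \<open>For \<open>n = 1\<close> both neighbours of a node coincide and the off-diagonal entries are \<open>-2\<close>.\<close>

definition affine_cartan :: "nat \<Rightarrow> nat \<Rightarrow> nat \<Rightarrow> int" where
  "affine_cartan n i j =
     (if i = j then 2
      else if n = 1 then -2
      else if j = (i + 1) mod (n + 1) \<or> i = (j + 1) mod (n + 1) then -1
      else 0)"

text \<open>The Cartan subalgebra has the basis of simple coroots \<open>Coroot 0, \<dots>, Coroot n\<close> and the
  scaling element \<open>Scaling\<close> (usually written \<open>d\<close>). Elements of its dual are given by their values
  on this basis; the coordinates \<open>Coroot i\<close> with \<open>i > n\<close> are unused and are \<open>0\<close>.\<close>

datatype cartan_basis = Coroot nat | Scaling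

type_synonym weight = "cartan_basis \<Rightarrow> complex"

definition simple_root :: "nat \<Rightarrow> nat \<Rightarrow> weight" where
  "simple_root n j k =
     (case k of
        Coroot i \<Rightarrow> if i \<le> n then of_int (affine_cartan n i j) else 0
      | Scaling \<Rightarrow> if j = 0 then 1 else 0)"

definition null_root :: "nat \<Rightarrow> weight" where
  "null_root n = (\<lambda>k. \<Sum>j\<le>n. simple_root n j k)"

definition fundamental_weight :: "nat \<Rightarrow> nat \<Rightarrow> weight" where
  "fundamental_weight r i k =
     (case k of
        Coroot j \<Rightarrow> if j = i mod (r + 1) then 1 else 0
      | Scaling \<Rightarrow> 0)"

datatype km_generator = EGen nat | FGen nat | HGen cartan_basis

abbreviation "eT i \<equiv> LGen (EGen i)"
abbreviation "fT i \<equiv> LGen (FGen i)"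
abbreviation "hT k \<equiv> LGen (HGen k)"

text \<open>The Chevalley--Serre relations. The first line discards the generators whose index is not a
  node of the Dynkin diagram, so that the generators that remain are \<open>e_i\<close>, \<open>f_i\<close>, \<open>h_i\<close>
  (\<open>0 \<le> i \<le> n\<close>) and \<open>d\<close>.\<close>

definition affine_relations :: "nat \<Rightarrow> (km_generator lie_term \<times> km_generator lie_term) set" where
  "affine_relations n =
     {(t, LZero) | t i. n < i \<and> t \<in> {eT i, fT i, hT (Coroot i)}} \<union>
     {(LBracket (hT k) (hT k'), LZero) | k k'. True} \<union>
     {(LBracket (hT k) (eT j), LScale (simple_root n j k) (eT j)) | k j. j \<le> n} \<union>
     {(LBracket (hT k) (fT j), LScale (- simple_root n j k) (fT j)) | k j. j \<le> n} \<union>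
     {(LBracket (eT i) (fT i), hT (Coroot i)) | i. i \<le> n} \<union>
     {(LBracket (eT i) (fT j), LZero) | i j. i \<le> n \<and> j \<le> n \<and> i \<noteq> j} \<union>
     {((LBracket (eT i) ^^ nat (1 - affine_cartan n i j)) (eT j), LZero)
        | i j. i \<le> n \<and> j \<le> n \<and> i \<noteq> j} \<union>
     {((LBracket (fT i) ^^ nat (1 - affine_cartan n i j)) (fT j), LZero)
        | i j. i \<le> n \<and> j \<le> n \<and> i \<noteq> j}"

definition affine_algebra_A ::
  "nat \<Rightarrow> (complex \<Rightarrow> 'g::ab_group_add \<Rightarrow> 'g) \<Rightarrow> ('g \<Rightarrow> 'g \<Rightarrow> 'g) \<Rightarrow> (km_generator \<Rightarrow> 'g) \<Rightarrow> bool"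
where
  "affine_algebra_A n scale bracket gen \<longleftrightarrow>
     lie_algebra_presented_by (affine_relations n) scale bracket gen"

section \<open>Irreducible highest weight modules and maximal dominant weights\<close>

definition weight_space ::
  "(km_generator \<Rightarrow> 'g) \<Rightarrow> (complex \<Rightarrow> 'v \<Rightarrow> 'v) \<Rightarrow> ('g \<Rightarrow> 'v \<Rightarrow> 'v) \<Rightarrow> weight \<Rightarrow> 'v set"
where
  "weight_space gen vscale act \<mu> = {v. \<forall>k. act (gen (HGen k)) v = vscale (\<mu> k) v}"

definition module_weights ::
  "(km_generator \<Rightarrow> 'g) \<Rightarrow> (complex \<Rightarrow> 'v::zero \<Rightarrow> 'v) \<Rightarrow> ('g \<Rightarrow> 'v \<Rightarrow> 'v) \<Rightarrow> weight set"
where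
  "module_weights gen vscale act = {\<mu>. \<exists>v\<in>weight_space gen vscale act \<mu>. v \<noteq> 0}"

definition highest_weight_vector ::
  "nat \<Rightarrow> (km_generator \<Rightarrow> 'g) \<Rightarrow> (complex \<Rightarrow> 'v::ab_group_add \<Rightarrow> 'v) \<Rightarrow> ('g \<Rightarrow> 'v \<Rightarrow> 'v) \<Rightarrow>
   weight \<Rightarrow> 'v \<Rightarrow> bool"
where
  "highest_weight_vector n gen vscale act \<Lambda> v \<longleftrightarrow>
     v \<noteq> 0 \<and>
     (\<forall>i\<le>n. act (gen (EGen i)) v = 0) \<and>
     v \<in> weight_space gen vscale act \<Lambda> \<and>
     (\<forall>S. lie_submodule vscale act S \<and> v \<in> S \<longrightarrow> S = UNIV)"

definition irreducible_highest_weight_module_A ::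
  "nat \<Rightarrow> (complex \<Rightarrow> 'g::ab_group_add \<Rightarrow> 'g) \<Rightarrow> ('g \<Rightarrow> 'g \<Rightarrow> 'g) \<Rightarrow> (km_generator \<Rightarrow> 'g) \<Rightarrow>
   weight \<Rightarrow> (complex \<Rightarrow> 'v::ab_group_add \<Rightarrow> 'v) \<Rightarrow> ('g \<Rightarrow> 'v \<Rightarrow> 'v) \<Rightarrow> bool"
where
  "irreducible_highest_weight_module_A n scale bracket gen \<Lambda> vscale act \<longleftrightarrow>
     affine_algebra_A n scale bracket gen \<and>
     lie_module scale bracket vscale act \<and>
     irreducible_module vscale act \<and>
     (\<exists>v. highest_weight_vector n gen vscale act \<Lambda> v)"

definition dominant_integral :: "nat \<Rightarrow> weight \<Rightarrow> bool" where
  "dominant_integral n \<mu> \<longleftrightarrow> (\<forall>i\<le>n. \<mu> (Coroot i) \<in> \<nat>)"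

definition max_dominant_weights ::
  "nat \<Rightarrow> (km_generator \<Rightarrow> 'g) \<Rightarrow> (complex \<Rightarrow> 'v::zero \<Rightarrow> 'v) \<Rightarrow> ('g \<Rightarrow> 'v \<Rightarrow> 'v) \<Rightarrow> weight set"
where
  "max_dominant_weights n gen vscale act =
     {\<mu> \<in> module_weights gen vscale act.
        (\<lambda>k. \<mu> k + null_root n k) \<notin> module_weights gen vscale act \<and> dominant_integral n \<mu>}"

end

(* Both sides are counted by the same combinatorial object.

   Representation theory: every weight of V(Lambda) lies in Lambda - Q_+, and if mu is a weight with
   mu(h_i) > 0 then mu - alpha_i is one too. Hence (Kac, Prop. 11.2) a dominant mu <= Lambda is
   always a weight: starting from Lambda one can keep subtracting simple roots, for otherwise
   the remaining difference x >= 0 would satisfy A x <= 0, so x would be a multiple of delta and mu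
   would have level 0. The maximal dominant weights are therefore the dominant classes of
   Lambda + Q modulo delta, that is the tuples (a_0, ..., a_n) of naturals with sum l and
   sum i a_i congruent to sum i m_i modulo n + 1.

   Combinatorics: write N = n + 1 and encode a tuple as the binary word 0 1^{a_0} 0 1^{a_1} ... .
   Modulo g = gcd(N, l) the number of pairs "0 before 1" is invariant under rotation of
   the word, while rotating the tuple shifts sum i a_i by -l modulo N. Double counting gives
   (N + l) * #tuples = g * #words, and the number of words is symmetric in N and l by reversing
   and complementing. *)
theory Submission
  imports Defs "HOL-Number_Theory.Cong"
begin

section \<open>Level-rank duality for compositions in a residue class\<close>

text \<open>This is the sum of i * a_i with positions counted from 0: removing the head lowers every
  later position by one, which costs \<open>sum_list xs\<close>.\<close>

primrec weighted_sum :: "nat list \<Rightarrow> nat" where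
  "weighted_sum [] = 0"
| "weighted_sum (x # xs) = sum_list xs + weighted_sum xs"

text \<open>In a binary word, \<open>False\<close> and \<open>True\<close> are the letters 0 and 1.\<close>

primrec ascents :: "bool list \<Rightarrow> nat" where
  "ascents [] = 0"
| "ascents (b # w) = (if b then 0 else count_list w True) + ascents w"

text \<open>The modulus \<open>q\<close> is separate from \<open>N\<close> because classes modulo
  \<open>N\<close> and modulo \<open>gcd N l\<close> both occur; the former describe weights, the
  latter are compatible with rotating words.\<close>

definition compositions :: "nat \<Rightarrow> nat \<Rightarrow> nat \<Rightarrow> nat \<Rightarrow> nat list set" where
  "compositions N l q c = {fs. length fs = N \<and> sum_list fs = l \<and> [weighted_sum fs = c] (mod q)}"

definition words :: "nat \<Rightarrow> nat \<Rightarrow> nat \<Rightarrow> nat \<Rightarrow> bool list set" where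
  "words N l q c =
     {w. count_list w False = N \<and> count_list w True = l \<and> [ascents w = c] (mod q)}"

lemma weighted_sum_append:
  "weighted_sum (xs @ ys) = weighted_sum xs + length xs * sum_list ys + weighted_sum ys"
  by (induction xs) auto

lemma weighted_sum_eq: "weighted_sum (map f [0..<N]) = (\<Sum>i<N. i * f i)"
  by (induction N) (auto simp: weighted_sum_append)

text \<open>The head moves from position 0 to the last position and every other entry moves down by
  one. Writing the head as \<open>hd (fs @ [0])\<close> gives the value 0 for the empty
  list.\<close>

lemma weighted_sum_rotate1:
  "weighted_sum (rotate1 fs) + sum_list fs = weighted_sum fs + length fs * hd (fs @ [0])"
  by (cases fs) (auto simp: weighted_sum_append)

lemma rotate1_compositions:
  assumes "fs \<in> compositions N l N (c + l)"
  shows "rotate1 fs \<in> compositions N l N c"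
proof -
  have fs: "length fs = N" "sum_list fs = l" "[weighted_sum fs = c + l] (mod N)"
    using assms by (auto simp: compositions_def)
  have "[weighted_sum (rotate1 fs) + l = weighted_sum fs] (mod N)"
    using weighted_sum_rotate1[of fs] fs(1,2) by (auto simp: cong_def)
  then have "[weighted_sum (rotate1 fs) + l = c + l] (mod N)"
    using fs(3) cong_trans by blast
  moreover have "sum_list (rotate1 fs) = l"
    using fs(2) by (cases fs) auto
  ultimately show ?thesis
    using fs(1) by (simp add: compositions_def cong_add_rcancel_nat)
qed

lemma finite_compositions: "finite (compositions N l q c)"
proof (rule finite_subset)
  show "compositions N l q c \<subseteq> {fs. set fs \<subseteq> {..l} \<and> length fs = N}"
    by (auto simp: compositions_def dest: member_le_sum_list)
qed (simp add: finite_lists_length_eq)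

section \<open>Binary words under rotation\<close>

lemma length_count_list: "length w = count_list w False + count_list w True"
  by (induction w) auto

lemma finite_words: "finite (words N l q c)"
proof (rule finite_subset)
  show "words N l q c \<subseteq> {w. set w \<subseteq> UNIV \<and> length w = N + l}"
    by (auto simp: words_def length_count_list)
qed (simp only: finite_lists_length_eq finite_UNIV)

text \<open>Moving a leading 0 to the end destroys one pair for each 1 of the word; moving a leading
  1 to the end creates one pair for each 0. Both changes are multiples of the gcd.\<close>

lemma rotate1_ascents:
  "[ascents (rotate1 w) = ascents w] (mod gcd (count_list w False) (count_list w True))"
proof (cases w)
  case (Cons b v)
  have *: "ascents (v @ [b]) = ascents v + (if b then count_list v False else 0)" for v b
    by (induction v) auto
  show ?thesis
  proof (cases b)
    case True
    then show ?thesis using Cons *[of v b]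
      by (auto simp: cong_def mod_add_right_eq[symmetric] intro: mod_mod_trivial)
  next
    case False
    then show ?thesis using Cons *[of v b]
      by (auto simp: cong_def mod_add_left_eq[symmetric])
  qed
qed auto

lemma count_list_rotate1: "count_list (rotate1 w) b = count_list w b"
  by (cases w) auto

lemma rotate1_words:
  "w \<in> words N l (gcd N l) c \<longleftrightarrow> rotate1 w \<in> words N l (gcd N l) c"
  using rotate1_ascents[of w]
  by (auto simp: words_def count_list_rotate1 intro: cong_trans cong_sym)

lemma bij_betw_rotate_words:
  "bij_betw (rotate i) (words N l (gcd N l) c) (words N l (gcd N l) c)"
proof -
  have inv: "rotate i w \<in> words N l (gcd N l) c \<longleftrightarrow> w \<in> words N l (gcd N l) c" for w
    by (induction i) (use rotate1_words in \<open>auto simp: rotate_def\<close>)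
  have "inj (rotate i :: bool list \<Rightarrow> _)"
    by (simp add: rotate_def inj_fn inj_rotate1)
  then have "inj_on (rotate i) (words N l (gcd N l) c)"
    by (rule inj_on_subset) simp
  moreover from this have "rotate i ` words N l (gcd N l) c = words N l (gcd N l) c"
    using finite_words inv by (intro endo_inj_surj) auto
  ultimately show ?thesis
    by (simp add: bij_betw_def)
qed

text \<open>Rotation by \<open>i\<close> permutes the words and brings the letter at position
  \<open>i\<close> to the front.\<close>

lemma card_words_False_nth:
  assumes "i < N + l"
  shows "card {w \<in> words N l (gcd N l) c. \<not> w ! i} = card {w \<in> words N l (gcd N l) c. \<not> w ! 0}"
proof -
  let ?W = "words N l (gcd N l) c"
  have "w ! i = rotate i w ! 0" if "w \<in> ?W" for w
  proof -
    have "i < length w"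
      using that assms by (simp add: words_def length_count_list)
    moreover from this have "w \<noteq> []"
      by auto
    ultimately show ?thesis
      using nth_rotate[of 0 w i] by simp
  qed
  then have "bij_betw (rotate i) {w \<in> ?W. \<not> w ! i} {w \<in> ?W. \<not> w ! 0}"
    by (intro bij_betw_Collect[OF bij_betw_rotate_words]) simp
  then show ?thesis
    by (rule bij_betw_same_card)
qed

text \<open>Double counting of the pairs (word, position of a 0): every word contains
  \<open>N\<close> zeros, and all \<open>N + l\<close> positions carry a 0 equally often.\<close>

lemma card_words_False_hd:
  "(N + l) * card {w \<in> words N l (gcd N l) c. \<not> w ! 0} = N * card (words N l (gcd N l) c)"
proof -
  let ?W = "words N l (gcd N l) c"
  have count: "card {i. i < N + l \<and> \<not> w ! i} = N" if "w \<in> ?W" for w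
  proof -
    have "count_list w False = card {i. i < length w \<and> \<not> w ! i}"
      by (subst count_list_eq_length_filter) (auto simp: length_filter_conv_card)
    then show ?thesis
      using that by (auto simp: words_def length_count_list)
  qed
  have "(N + l) * card {w \<in> ?W. \<not> w ! 0} = (\<Sum>i<N + l. card {w \<in> ?W. \<not> w ! i})"
    by (simp add: card_words_False_nth)
  also have "\<dots> = (\<Sum>w\<in>?W. card {i \<in> {..<N + l}. \<not> w ! i})"
    by (rule sum_multicount_gen) (auto simp: finite_words)
  also have "\<dots> = N * card ?W"
    by (simp add: count)
  finally show ?thesis .
qed

section \<open>Tuples as binary words that start with 0\<close>

definition encode :: "nat list \<Rightarrow> bool list" where
  "encode fs = concat (map (\<lambda>a. False # replicate a True) fs)"

lemma encode_simps: "encode [] = []" "encode (a # fs) = False # replicate a True @ encode fs"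
  by (simp_all add: encode_def)

lemma encode_append: "encode (fs @ gs) = encode fs @ encode gs"
  by (simp add: encode_def)

lemma count_list_replicate: "count_list (replicate n x) y = (if x = y then n else 0)"
  by (induction n) auto

lemma count_encode:
  "count_list (encode fs) False = length fs" "count_list (encode fs) True = sum_list fs"
  by (induction fs) (auto simp: encode_simps count_list_replicate)

text \<open>A 1 in block i is preceded by i + 1 zeros, the one opening its own block included; this
  accounts for the extra \<open>sum_list fs\<close>, which vanishes modulo
  \<open>gcd N l\<close>.\<close>

lemma ascents_encode: "ascents (encode fs) = weighted_sum fs + sum_list fs"
proof (induction fs)
  case (Cons a fs)
  have "ascents (replicate a True @ w) = ascents w" for w
    by (induction a) auto
  with Cons show ?case
    by (simp add: encode_simps count_encode count_list_replicate)
qed (simp add: encode_simps)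

lemma inj_encode: "inj encode"
proof (rule injI)
  fix fs gs show "encode fs = encode gs \<Longrightarrow> fs = gs"
  proof (induction fs arbitrary: gs)
    case Nil
    then show ?case by (cases gs) (auto simp: encode_simps)
  next
    case (Cons a fs)
    then obtain b gs' where gs: "gs = b # gs'"
      by (cases gs) (auto simp: encode_simps)
    \<comment> \<open>The first run of ones stops at the 0 that opens the next block, so the word
      determines the first entry.\<close>
    have split: "takeWhile id (replicate c True @ encode hs) = replicate c True" for c hs
      by (cases hs) (auto simp: encode_simps takeWhile_append)
    have eq: "replicate a True @ encode fs = replicate b True @ encode gs'"
      using Cons.prems gs by (simp add: encode_simps)
    then have "replicate a True = replicate b True"
      using split by metis
    then have "a = b"
      by (metis length_replicate)
    then show ?case
      using eq Cons.IH gs by simp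
  qed
qed

text \<open>The word is read from the right: a final 0 opens a new block of size 0, a final 1
  enlarges the last block.\<close>

lemma encode_surj:
  assumes "w = [] \<or> \<not> w ! 0"
  shows "\<exists>fs. w = encode fs"
  using assms
proof (induction w rule: rev_induct)
  case Nil
  then show ?case by (metis encode_simps(1))
next
  case (snoc b w)
  then obtain fs where fs: "w = encode fs"
    by (cases w) auto
  show ?case
  proof (cases b)
    case False
    then have "w @ [b] = encode (fs @ [0])"
      by (simp add: fs encode_append encode_simps)
    then show ?thesis ..
  next
    case True
    then have "w \<noteq> []"
      using snoc.prems by auto
    then have "fs \<noteq> []"
      using fs by (auto simp: encode_simps)
    then obtain gs a where gs: "fs = gs @ [a]"
      by (metis rev_exhaust)
    have "w @ [b] = encode (gs @ [Suc a])"
      by (simp add: True fs gs encode_append encode_simps replicate_append_same)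
    then show ?thesis ..
  qed
qed

text \<open>\<open>encode\<close> is the bijection. Since \<open>N > 0\<close>, an encoded tuple is
  a nonempty word, so its letter at position 0 is indeed the opening 0.\<close>

lemma card_compositions_gcd:
  assumes "N > 0"
  shows "card (compositions N l (gcd N l) c) = card {w \<in> words N l (gcd N l) c. \<not> w ! 0}"
proof -
  have cong: "[ascents (encode fs) = c] (mod gcd N l) \<longleftrightarrow> [weighted_sum fs = c] (mod gcd N l)"
    if "sum_list fs = l" for fs
  proof -
    have "l mod gcd N l = 0"
      by simp
    then show ?thesis
      unfolding ascents_encode cong_def that by (metis add.right_neutral mod_add_right_eq)
  qed
  have "encode ` compositions N l (gcd N l) c = {w \<in> words N l (gcd N l) c. \<not> w ! 0}"
  proof (intro equalityI subsetI)
    fix w assume "w \<in> encode ` compositions N l (gcd N l) c"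
    then obtain fs where fs: "fs \<in> compositions N l (gcd N l) c" "w = encode fs"
      by blast
    then have "\<not> w ! 0"
      using assms by (cases fs) (auto simp: compositions_def encode_simps)
    then show "w \<in> {w \<in> words N l (gcd N l) c. \<not> w ! 0}"
      using fs cong by (auto simp: compositions_def words_def count_encode)
  next
    fix w assume w: "w \<in> {w \<in> words N l (gcd N l) c. \<not> w ! 0}"
    then obtain fs where "w = encode fs"
      using encode_surj by blast
    then show "w \<in> encode ` compositions N l (gcd N l) c"
      using w cong by (auto simp: compositions_def words_def count_encode)
  qed
  then show ?thesis
    by (metis card_image inj_encode inj_on_subset subset_UNIV)
qed

section \<open>Dependence of the number of tuples on the residue class\<close>

lemma card_compositions_add:
  assumes "N > 0"
  shows "card (compositions N l N (c + l)) = card (compositions N l N c)"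
proof -
  \<comment> \<open>Rotation is injective, so sizes cannot decrease from the class of
    \<open>c + l\<close> to that of \<open>c\<close>. After \<open>N\<close> such steps the class is
    the initial one, because \<open>N * l\<close> is 0 modulo \<open>N\<close>; hence all these
    sizes agree.\<close>
  have le: "card (compositions N l N (c + l)) \<le> card (compositions N l N c)" for c
    by (rule card_inj_on_le[of rotate1])
       (auto simp: rotate1_compositions finite_compositions intro: inj_on_subset[OF inj_rotate1])
  have "card (compositions N l N (c + k * l)) \<le> card (compositions N l N (c + l))" if "k > 0" for k
    using that
  proof (induction k)
    case (Suc k)
    then show ?case
      using le[of "c + k * l"] by (cases "k = 0") (auto simp: ac_simps)
  qed simp
  from this[OF assms] have "card (compositions N l N (c + N * l)) \<le> card (compositions N l N (c + l))" .
  moreover have "compositions N l N (c + N * l) = compositions N l N c"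
    by (simp add: compositions_def cong_def)
  ultimately show ?thesis
    using le[of c] by simp
qed

text \<open>By Bezout, the multiples of \<open>l\<close> modulo \<open>N\<close> are the multiples
  of \<open>gcd N l\<close>, so shifts by \<open>l\<close> connect any two residues that agree
  modulo the gcd.\<close>

lemma card_compositions_cong:
  assumes "N > 0" "[c = d] (mod gcd N l)"
  shows "card (compositions N l N c) = card (compositions N l N d)"
proof -
  have shift: "card (compositions N l N (c + k * l)) = card (compositions N l N c)" for k c
  proof (induction k)
    case (Suc k)
    then show ?case
      using card_compositions_add[OF assms(1), of l "c + k * l"] by (simp add: ac_simps)
  qed simp
  have main: "card (compositions N l N c) = card (compositions N l N d)"
    if "c \<le> d" "[c = d] (mod gcd N l)" for c d
  proof -
    have "gcd l N dvd d - c"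
      using that cong_altdef_nat[of c d "gcd N l"] by (metis cong_sym_eq cong_altdef_nat gcd.commute)
    then obtain j where j: "d - c = gcd l N * j" ..
    \<comment> \<open>\<open>x\<close> is a Bezout coefficient: \<open>j * x\<close> shifts by
      \<open>l\<close> move \<open>c\<close> to \<open>d\<close> modulo \<open>N\<close>.\<close>
    obtain x where "[l * x = gcd l N] (mod N)"
      using cong_solve_nat by blast
    then have "[c + j * x * l = c + (d - c)] (mod N)"
      unfolding j by (metis cong_add_lcancel_nat cong_scalar_right mult.assoc mult.commute)
    then have "[c + j * x * l = d] (mod N)"
      using that(1) by simp
    then have "compositions N l N (c + j * x * l) = compositions N l N d"
      by (simp add: compositions_def cong_def)
    then show ?thesis
      using shift by metis
  qed
  show ?thesis
    using main[of c d] main[of d c] assms(2) by (metis cong_sym nle_le)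
qed

lemma card_residues:
  assumes "N > 0" "g dvd N"
  shows "card {r. r < N \<and> [r = c] (mod g)} = N div g"
proof -
  obtain q where N: "N = g * q"
    using assms(2) ..
  have g: "g > 0"
    using dvd_pos_nat[OF assms] .
  have "{r. r < N \<and> [r = c] (mod g)} = (\<lambda>j. c mod g + g * j) ` {..<q}"
  proof (intro equalityI subsetI)
    fix r assume r: "r \<in> {r. r < N \<and> [r = c] (mod g)}"
    then have "r = c mod g + g * (r div g)"
      using mod_mult_div_eq[of r g] by (simp add: cong_def)
    moreover have "r div g < q"
      using r g N by (simp add: div_less_iff_less_mult mult.commute)
    ultimately show "r \<in> (\<lambda>j. c mod g + g * j) ` {..<q}"
      by blast
  next
    fix r assume "r \<in> (\<lambda>j. c mod g + g * j) ` {..<q}"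
    then obtain j where j: "r = c mod g + g * j" "j < q"
      by auto
    have "r < g * Suc j"
      using g by (simp add: j)
    also have "\<dots> \<le> N"
      unfolding N using j(2) by (intro mult_le_mono2) simp
    finally show "r \<in> {r. r < N \<and> [r = c] (mod g)}"
      by (simp add: j cong_def)
  qed
  moreover have "inj_on (\<lambda>j. c mod g + g * j) {..<q}"
    using g by (auto simp: inj_on_def)
  ultimately show ?thesis
    using N g by (simp add: card_image)
qed

text \<open>A class modulo the gcd splits into \<open>N div gcd N l\<close> classes modulo
  \<open>N\<close>, all of the same size.\<close>

lemma card_compositions_refine:
  assumes "N > 0"
  shows "card (compositions N l (gcd N l) c) = N div gcd N l * card (compositions N l N c)"
proof -
  let ?R = "{r. r < N \<and> [r = c] (mod gcd N l)}"
  have split: "compositions N l (gcd N l) c = (\<Union>r\<in>?R. compositions N l N r)"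
  proof (intro equalityI subsetI)
    fix fs assume "fs \<in> compositions N l (gcd N l) c"
    then show "fs \<in> (\<Union>r\<in>?R. compositions N l N r)"
      using assms by (intro UN_I[of "weighted_sum fs mod N"])
        (auto simp: compositions_def cong_def mod_mod_cancel)
  next
    fix fs assume "fs \<in> (\<Union>r\<in>?R. compositions N l N r)"
    then obtain r where r: "[r = c] (mod gcd N l)" and fs: "fs \<in> compositions N l N r"
      by blast
    then have "[weighted_sum fs = r] (mod gcd N l)"
      using cong_dvd_modulus_nat[of "weighted_sum fs" r N "gcd N l"] by (simp add: compositions_def)
    then show "fs \<in> compositions N l (gcd N l) c"
      using cong_trans[OF _ r] fs by (simp add: compositions_def)
  qed
  have "card (compositions N l (gcd N l) c) = (\<Sum>r\<in>?R. card (compositions N l N r))"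
    unfolding split
  proof (rule card_UN_disjoint)
    have "r = r'" if "r < N" "r' < N" "fs \<in> compositions N l N r \<inter> compositions N l N r'" for r r' fs
    proof -
      have "[r = r'] (mod N)"
        using that(3) unfolding compositions_def by (blast intro: cong_trans cong_sym)
      then show ?thesis
        using that(1,2) by (rule cong_less_modulus_unique_nat)
    qed
    then show "\<forall>r\<in>?R. \<forall>r'\<in>?R. r \<noteq> r' \<longrightarrow> compositions N l N r \<inter> compositions N l N r' = {}"
      by blast
    show "finite ?R"
      by simp
    show "\<forall>r\<in>?R. finite (compositions N l N r)"
      by (simp add: finite_compositions)
  qed
  also have "\<dots> = (\<Sum>r\<in>?R. card (compositions N l N c))"
  proof (rule sum.cong[OF HOL.refl])
    fix r assume "r \<in> ?R"
    then show "card (compositions N l N r) = card (compositions N l N c)"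
      by (intro card_compositions_cong[OF assms]) simp
  qed
  also have "\<dots> = card ?R * card (compositions N l N c)"
    by simp
  finally show ?thesis
    unfolding card_residues[OF assms gcd_dvd1] .
qed

section \<open>Comparison with all words, and exchange of \<open>N\<close> and
  \<open>l\<close>\<close>

lemma card_compositions_words:
  assumes "N > 0"
  shows "(N + l) * card (compositions N l N c) = gcd N l * card (words N l (gcd N l) c)"
proof -
  define g where "g = gcd N l"
  then have "g dvd N" "g > 0"
    using assms by simp_all
  then obtain q where q: "N = g * q"
    by blast
  then have "q > 0"
    using assms by (metis gr0I mult_0_right)
  have "N div g = q"
    unfolding q using \<open>g > 0\<close> by simp
  \<comment> \<open>The factor \<open>q\<close> turns the tuples of one class modulo
    \<open>N\<close> into those of a class modulo \<open>g\<close>, that is, into the words starting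
    with 0. It is cancelled at the end.\<close>
  then have "q * ((N + l) * card (compositions N l N c)) =
      (N + l) * card {w \<in> words N l g c. \<not> w ! 0}"
    using card_compositions_refine[OF assms, of l c] card_compositions_gcd[OF assms, of l c]
    by (simp only: g_def mult.left_commute)
  also have "\<dots> = N * card (words N l g c)"
    unfolding g_def by (rule card_words_False_hd)
  also have "\<dots> = q * (g * card (words N l g c))"
    by (simp add: q)
  finally have "(N + l) * card (compositions N l N c) = g * card (words N l g c)"
    using \<open>q > 0\<close> by simp
  then show ?thesis
    by (simp only: g_def)
qed

text \<open>Reversal and complementation each turn a pair "0 before 1" into a pair "1 before 0", so
  together they preserve \<open>ascents\<close> while exchanging the two letter counts.\<close>

lemma card_words_swap: "card (words N l q c) = card (words l N q c)"
proof -
  define f where "f w = rev (map Not w)" for w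
  have count: "count_list (f w) b = count_list w (\<not> b)" for w b
    by (induction w) (auto simp: f_def)
  have snoc: "ascents (v @ [b]) = ascents v + (if b then count_list v False else 0)" for v b
    by (induction v) auto
  have asc: "ascents (f w) = ascents w" for w
  proof (induction w)
    case (Cons b w)
    then show ?case
      using count[of w False] by (simp add: snoc f_def)
  qed (simp add: f_def)
  have "f (f w) = w" for w
    by (simp add: f_def rev_map comp_def)
  then have "bij_betw f (words N l q c) (words l N q c)"
    by (intro bij_betw_byWitness[where f' = f]) (auto simp: words_def count asc)
  then show ?thesis
    by (rule bij_betw_same_card)
qed

theorem card_compositions_swap:
  assumes "N > 0" "l > 0"
  shows "card (compositions N l N c) = card (compositions l N l c)"
proof -
  have "(N + l) * card (compositions N l N c) = (N + l) * card (compositions l N l c)"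
    using card_compositions_words[OF assms(1), of l c] card_compositions_words[OF assms(2), of N c]
    by (simp add: card_words_swap[of N l] gcd.commute add.commute)
  then show ?thesis
    using assms by simp
qed

section \<open>The affine Cartan matrix as a cyclic second difference\<close>

definition cyc_succ :: "nat \<Rightarrow> nat \<Rightarrow> nat" where
  "cyc_succ n i = (if i = n then 0 else Suc i)"

definition cyc_pred :: "nat \<Rightarrow> nat \<Rightarrow> nat" where
  "cyc_pred n i = (if i = 0 then n else i - 1)"

definition cartan_apply :: "nat \<Rightarrow> (nat \<Rightarrow> int) \<Rightarrow> nat \<Rightarrow> int" where
  "cartan_apply n x i = (\<Sum>j\<le>n. affine_cartan n i j * x j)"

definition root_comb :: "nat \<Rightarrow> (nat \<Rightarrow> int) \<Rightarrow> weight" where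
  "root_comb n x c = (\<Sum>j\<le>n. of_int (x j) * simple_root n j c)"

text \<open>The set \<Lambda> - Q_+. Coefficients are integers with an explicit sign condition, so
  that differences and shifts by the null root remain coefficient functions.\<close>

definition weights_below :: "nat \<Rightarrow> weight \<Rightarrow> weight set" where
  "weights_below n \<Lambda> = {\<mu>. \<exists>x. (\<forall>j\<le>n. 0 \<le> x j) \<and> \<mu> = (\<lambda>c. \<Lambda> c - root_comb n x c)}"

lemma weights_belowI:
  "\<forall>j\<le>n. 0 \<le> x j \<Longrightarrow> (\<lambda>c. \<Lambda> c - root_comb n x c) \<in> weights_below n \<Lambda>"
  unfolding weights_below_def by blast

text \<open>The neighbours are subtracted as separate indicators: for \<open>n = 1\<close> they
  coincide and the two terms add up to -2, so one formula covers every rank.\<close>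

lemma affine_cartan_eq:
  assumes "n \<ge> 1" "i \<le> n" "j \<le> n"
  shows "affine_cartan n i j =
    (if j = i then 2 else 0) - (if j = cyc_succ n i then 1 else 0) - (if j = cyc_pred n i then 1 else 0)"
proof (cases "n = 1")
  case True
  then have "i \<in> {0, 1}" "j \<in> {0, 1}"
    using assms by auto
  then show ?thesis
    using True by (auto simp: affine_cartan_def cyc_succ_def cyc_pred_def)
next
  case False
  have "(i + 1) mod (n + 1) = cyc_succ n i" "(j + 1) mod (n + 1) = cyc_succ n j"
    using assms by (auto simp: cyc_succ_def)
  moreover have "i = cyc_succ n j \<longleftrightarrow> j = cyc_pred n i"
    using assms by (auto simp: cyc_succ_def cyc_pred_def)
  moreover have "cyc_succ n i \<noteq> cyc_pred n i" "cyc_succ n i \<noteq> i" "cyc_pred n i \<noteq> i"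
    using assms False by (auto simp: cyc_succ_def cyc_pred_def)
  ultimately show ?thesis
    using False by (auto simp: affine_cartan_def)
qed

lemma cartan_apply_eq:
  assumes "n \<ge> 1" "i \<le> n"
  shows "cartan_apply n x i = 2 * x i - x (cyc_succ n i) - x (cyc_pred n i)"
proof -
  have "cyc_succ n i \<le> n" "cyc_pred n i \<le> n"
    using assms by (auto simp: cyc_succ_def cyc_pred_def)
  have "(\<Sum>j\<le>n. ((if j = i then 2 else 0) - (if j = cyc_succ n i then 1 else 0)
      - (if j = cyc_pred n i then 1 else 0)) * x j) =
    (\<Sum>j\<le>n. if j = i then 2 * x j else 0) - (\<Sum>j\<le>n. if j = cyc_succ n i then x j else 0)
      - (\<Sum>j\<le>n. if j = cyc_pred n i then x j else 0)"
    unfolding sum_subtractf[symmetric] by (rule sum.cong) auto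
  also have "\<dots> = 2 * x i - x (cyc_succ n i) - x (cyc_pred n i)"
    using assms \<open>cyc_succ n i \<le> n\<close> \<open>cyc_pred n i \<le> n\<close> by simp
  finally show ?thesis
    unfolding cartan_apply_def using assms by (simp add: affine_cartan_eq)
qed

lemma sum_cyc_succ: "(\<Sum>i\<le>n. g (cyc_succ n i)) = (\<Sum>i\<le>n. g i)"
  by (rule sum.reindex_bij_witness[where i = "cyc_pred n" and j = "cyc_succ n"])
     (auto simp: cyc_succ_def cyc_pred_def)

lemma sum_cyc_pred: "(\<Sum>i\<le>n. g (cyc_pred n i)) = (\<Sum>i\<le>n. g i)"
  by (rule sum.reindex_bij_witness[where i = "cyc_succ n" and j = "cyc_pred n"])
     (auto simp: cyc_succ_def cyc_pred_def)

lemma sum_cartan_apply: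
  assumes "n \<ge> 1"
  shows "(\<Sum>i\<le>n. cartan_apply n x i) = 0"
  using assms
  by (simp add: cartan_apply_eq sum_subtractf sum_cyc_succ sum_cyc_pred flip: sum_distrib_left)

text \<open>Summation by parts moves the second difference onto the index function i. It vanishes
  there except at the ends 0 and \<open>n\<close> of the cycle, where it is -(n + 1) and n +
  1.\<close>

lemma weighted_sum_cartan_apply:
  assumes "n \<ge> 1"
  shows "(int n + 1) dvd (\<Sum>i\<le>n. int i * cartan_apply n x i)"
proof -
  let ?g = "\<lambda>i. int (cyc_pred n i) * x i" and ?h = "\<lambda>i. int (cyc_succ n i) * x i"
  have inv: "cyc_pred n (cyc_succ n i) = i" "cyc_succ n (cyc_pred n i) = i" if "i \<le> n" for i
    using that by (auto simp: cyc_succ_def cyc_pred_def)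
  have "(\<Sum>i\<le>n. int i * x (cyc_succ n i)) = (\<Sum>i\<le>n. ?g i)"
    using sum_cyc_succ[of ?g n] by (simp add: inv)
  moreover have "(\<Sum>i\<le>n. int i * x (cyc_pred n i)) = (\<Sum>i\<le>n. ?h i)"
    using sum_cyc_pred[of ?h n] by (simp add: inv)
  ultimately have "(\<Sum>i\<le>n. int i * cartan_apply n x i) =
      (\<Sum>i\<le>n. 2 * int i * x i) - (\<Sum>i\<le>n. ?g i) - (\<Sum>i\<le>n. ?h i)"
    using assms by (simp add: cartan_apply_eq algebra_simps sum_subtractf sum.distrib)
  also have "\<dots> = (\<Sum>i\<le>n. (2 * int i - int (cyc_pred n i) - int (cyc_succ n i)) * x i)"
    by (simp add: left_diff_distrib sum_subtractf)
  finally have *: "(\<Sum>i\<le>n. int i * cartan_apply n x i) =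
      (\<Sum>i\<le>n. (2 * int i - int (cyc_pred n i) - int (cyc_succ n i)) * x i)" .
  have "(int n + 1) dvd (2 * int i - int (cyc_pred n i) - int (cyc_succ n i))" if "i \<le> n" for i
  proof -
    have "2 * int i - int (cyc_pred n i) - int (cyc_succ n i) \<in> {0, int n + 1, - (int n + 1)}"
      using that assms by (auto simp: cyc_succ_def cyc_pred_def of_nat_diff)
    then show ?thesis
      by (metis dvd_0_right dvd_minus_iff dvd_refl empty_iff insert_iff)
  qed
  then show ?thesis
    unfolding * by (intro dvd_sum dvd_mult2) auto
qed

section \<open>Kernel and image of the affine Cartan matrix over the integers\<close>

lemma cartan_apply_diff: "cartan_apply n (\<lambda>j. x j - y j) i = cartan_apply n x i - cartan_apply n y i"
  by (simp add: cartan_apply_def right_diff_distrib sum_subtractf)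

text \<open>Vanishing second differences make \<open>x\<close> an arithmetic progression, and the
  equation at node \<open>n\<close>, where the cycle closes, forces its slope to be 0. So the kernel
  consists of the multiples of the null root.\<close>

lemma cartan_kernel:
  assumes "n \<ge> 1" and ker: "\<And>i. i \<le> n \<Longrightarrow> cartan_apply n x i = 0" and "i \<le> n"
  shows "x i = x 0"
proof -
  have linear: "x i = x 0 + int i * (x 1 - x 0)" if "i \<le> n" for i
    using that
  proof (induction i rule: less_induct)
    case (less i)
    consider "i = 0" | "i = 1" | k where "i = Suc (Suc k)"
      by (metis One_nat_def not0_implies_Suc)
    then show ?case
    proof cases
      case 3
      then have "2 * x (Suc k) - x (Suc (Suc k)) - x k = 0"
        using ker[of "Suc k"] less.prems cartan_apply_eq[of n "Suc k" x] assms(1)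
        by (simp add: cyc_succ_def cyc_pred_def)
      then show ?thesis
        using less.IH[of k] less.IH[of "Suc k"] less.prems 3 by (simp add: algebra_simps)
    qed auto
  qed
  have "2 * x n - x 0 - x (n - 1) = 0"
    using ker[of n] cartan_apply_eq[of n n x] assms(1) by (simp add: cyc_succ_def cyc_pred_def)
  moreover have "x (n - 1) = x 0 + (int n - 1) * (x 1 - x 0)"
    using linear[of "n - 1"] assms(1) by (simp add: of_nat_diff)
  ultimately have "(int n + 1) * (x 1 - x 0) = 0"
    using linear[of n] by (simp add: algebra_simps)
  then show ?thesis
    using linear[OF assms(3)] by auto
qed

text \<open>The two necessary conditions on an image vector also suffice: summing \<open>b\<close>
  twice inverts the second difference, and the divisibility supplies an integral initial
  slope.\<close>

lemma cartan_solve: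
  fixes b :: "nat \<Rightarrow> int"
  assumes "n \<ge> 1" "(\<Sum>i\<le>n. b i) = 0" "(int n + 1) dvd (\<Sum>i\<le>n. int i * b i)"
  obtains x where "\<And>i. i \<le> n \<Longrightarrow> cartan_apply n x i = b i"
proof -
  obtain t where t: "(\<Sum>i\<le>n. int i * b i) = (int n + 1) * t"
    using assms(3) by (elim dvdE)
  \<comment> \<open>The double sum of -\<open>b\<close>, starting at 0 with slope -\<open>t\<close>;
    \<open>t\<close> is the value that makes \<open>x (Suc n)\<close> return to
    \<open>x 0\<close>.\<close>
  define x where "x i = - int i * t - (\<Sum>j<i. (int i - int j) * b j)" for i
  have step: "x (Suc i) - x i = - t - (\<Sum>j\<le>i. b j)" for i
  proof -
    have "(\<Sum>j<Suc i. (int (Suc i) - int j) * b j) = (\<Sum>j<Suc i. (int i - int j) * b j) + (\<Sum>j<Suc i. b j)"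
      unfolding sum.distrib[symmetric] by (rule sum.cong) (auto simp: algebra_simps)
    also have "(\<Sum>j<Suc i. (int i - int j) * b j) = (\<Sum>j<i. (int i - int j) * b j)"
      by simp
    finally show ?thesis
      by (simp add: x_def algebra_simps lessThan_Suc_atMost)
  qed
  have "(\<Sum>j<Suc n. (int (Suc n) - int j) * b j) = (int n + 1) * (\<Sum>j\<le>n. b j) - (\<Sum>j\<le>n. int j * b j)"
    unfolding lessThan_Suc_atMost by (simp add: left_diff_distrib sum_subtractf sum_distrib_left add.commute)
  then have closed: "x (Suc n) = x 0"
    using assms(2) t by (simp add: x_def del: sum.lessThan_Suc) (simp add: algebra_simps)
  have "cartan_apply n x i = b i" if "i \<le> n" for i
  proof -
    have succ: "x (cyc_succ n i) = x (Suc i)"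
      using closed by (auto simp: cyc_succ_def)
    have "x i - x (cyc_pred n i) = - t - (\<Sum>j<i. b j)"
    proof (cases i)
      case 0
      then show ?thesis
        using step[of n] closed assms(2) by (simp add: cyc_pred_def)
    next
      case (Suc k)
      then show ?thesis
        using step[of k] by (simp add: cyc_pred_def lessThan_Suc_atMost)
    qed
    moreover have "(\<Sum>j\<le>i. b j) = (\<Sum>j<i. b j) + b i"
      by (simp flip: lessThan_Suc_atMost)
    ultimately show ?thesis
      using step[of i] cartan_apply_eq[OF assms(1) that, of x] succ by simp
  qed
  then show ?thesis
    by (rule that)
qed

section \<open>Integer combinations of simple roots\<close>

lemma root_comb_Coroot:
  "i \<le> n \<Longrightarrow> root_comb n x (Coroot i) = of_int (cartan_apply n x i)"
  by (simp add: root_comb_def simple_root_def cartan_apply_def mult.commute)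

lemma root_comb_Scaling: "root_comb n x Scaling = of_int (x 0)"
proof -
  have "root_comb n x Scaling = (\<Sum>j\<le>n. if j = 0 then of_int (x j) else 0)"
    unfolding root_comb_def by (rule sum.cong) (auto simp: simple_root_def)
  then show ?thesis
    by simp
qed

lemma root_comb_cong: "(\<And>j. j \<le> n \<Longrightarrow> x j = y j) \<Longrightarrow> root_comb n x = root_comb n y"
  by (auto simp: root_comb_def fun_eq_iff)

lemma root_comb_update:
  assumes "i \<le> n"
  shows "root_comb n (x(i := x i + d)) c = root_comb n x c + of_int d * simple_root n i c"
proof -
  have "root_comb n (x(i := x i + d)) c =
      (\<Sum>j\<le>n. of_int (x j) * simple_root n j c + (if j = i then of_int d * simple_root n j c else 0))"
    unfolding root_comb_def by (rule sum.cong) (auto simp: algebra_simps)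
  then show ?thesis
    using assms by (simp add: root_comb_def sum.distrib)
qed

lemma root_comb_add_const:
  "root_comb n (\<lambda>j. x j + d) c = root_comb n x c + of_int d * null_root n c"
  by (simp add: root_comb_def null_root_def distrib_right sum.distrib sum_distrib_left)

text \<open>The coroot coordinates determine the coefficients up to a common constant, and
  \<open>Scaling\<close> reads off the coefficient at node 0.\<close>

lemma root_comb_inject:
  assumes "n \<ge> 1" "root_comb n x = root_comb n y" "i \<le> n"
  shows "x i = y i"
proof -
  have "x i - y i = x 0 - y 0"
  proof (rule cartan_kernel[OF assms(1) _ assms(3), where x = "\<lambda>j. x j - y j"])
    fix i assume "i \<le> n"
    then show "cartan_apply n (\<lambda>j. x j - y j) i = 0"
      using fun_cong[OF assms(2), of "Coroot i"]
      by (simp add: root_comb_Coroot cartan_apply_diff)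
  qed
  moreover have "x 0 = y 0"
    using fun_cong[OF assms(2), of Scaling] by (simp add: root_comb_Scaling)
  ultimately show ?thesis
    by simp
qed

text \<open>In the application \<open>a\<close> holds the coroot values of the target weight and
  \<open>x\<close> the simple roots still to be subtracted; the node found is one where subtraction
  can continue.\<close>

lemma exists_positive_coroot:
  assumes "n \<ge> 1" and nonneg: "\<And>i. i \<le> n \<Longrightarrow> 0 \<le> x i" and "j \<le> n" "x j > 0"
    and "(\<Sum>i\<le>n. a i) > 0" and a: "\<And>i. i \<le> n \<Longrightarrow> 0 \<le> a i"
  shows "\<exists>i\<le>n. x i > 0 \<and> a i + cartan_apply n x i > 0"
proof (rule ccontr)
  assume contra: "\<not> ?thesis"
  have le: "cartan_apply n x i \<le> 0" if "i \<le> n" for i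
  proof (cases "x i > 0")
    case True
    then show ?thesis
      using contra a[OF that] that by force
  next
    \<comment> \<open>Here \<open>x i = 0\<close>, so only the nonpositive contributions of the two
      neighbours remain.\<close>
    case False
    have "cyc_succ n i \<le> n" "cyc_pred n i \<le> n"
      using that by (auto simp: cyc_succ_def cyc_pred_def)
    then show ?thesis
      using False cartan_apply_eq[OF assms(1) that, of x]
        nonneg[of "cyc_succ n i"] nonneg[of "cyc_pred n i"] by simp
  qed
  \<comment> \<open>Nonpositive numbers with total 0 all vanish.\<close>
  have zero: "cartan_apply n x i = 0" if "i \<le> n" for i
  proof -
    have "(\<Sum>i\<le>n. - cartan_apply n x i) = 0"
      using sum_cartan_apply[OF assms(1), of x] by (simp add: sum_negf)
    then have "\<forall>i\<in>{..n}. - cartan_apply n x i = 0"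
      by (subst (asm) sum_nonneg_eq_0_iff) (auto simp: le)
    then show ?thesis
      using that by simp
  qed
  have "x i = x 0" if "i \<le> n" for i
    by (rule cartan_kernel[OF assms(1) zero that])
  then have "x i > 0" if "i \<le> n" for i
    using that assms(3,4) by metis
  then have "a i \<le> 0" if "i \<le> n" for i
    using contra zero[OF that] that by fastforce
  then have "(\<Sum>i\<le>n. a i) \<le> 0"
    by (intro sum_nonpos) auto
  then show False
    using assms(5) by simp
qed

section \<open>Weights of highest weight modules\<close>

locale affine_highest_weight_module =
  lie_module scale bracket vscale act
  for scale :: "complex \<Rightarrow> 'g::ab_group_add \<Rightarrow> 'g" and bracket :: "'g \<Rightarrow> 'g \<Rightarrow> 'g"
    and vscale :: "complex \<Rightarrow> 'v::ab_group_add \<Rightarrow> 'v" and act :: "'g \<Rightarrow> 'v \<Rightarrow> 'v" +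
  fixes n :: nat and gen :: "km_generator \<Rightarrow> 'g" and \<Lambda> :: weight and v :: 'v
  assumes rank_pos: "n \<ge> 1"
    and presented: "lie_algebra_presented_by (affine_relations n) scale bracket gen"
    and highest: "highest_weight_vector n gen vscale act \<Lambda> v"
begin

abbreviation "e i \<equiv> act (gen (EGen i))"
abbreviation "f i \<equiv> act (gen (FGen i))"
abbreviation "h k \<equiv> act (gen (HGen k))"
abbreviation "wt_space \<equiv> weight_space gen vscale act"
abbreviation "wts \<equiv> module_weights gen vscale act"

section \<open>Commutation relations of the operators on the module\<close>

lemma eval_relation:
  "(s, t) \<in> affine_relations n \<Longrightarrow> lie_eval scale bracket gen s = lie_eval scale bracket gen t"
  using presented lie_derivable.rel[of s t "affine_relations n"]
  unfolding lie_algebra_presented_by_def by blast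

lemma act_zero_left [simp]: "act 0 u = 0"
  using act_scale_left[of 0 0 u] by simp

lemma act_zero_right [simp]: "act x 0 = 0"
  using act_scale_right[of x 0 0] by simp

lemma act_minus_left: "act (- x) u = - act x u"
  using act_add_left[of x "- x" u] by (simp add: eq_neg_iff_add_eq_0 add.commute)

lemma act_sum_right: "act x (\<Sum>a\<in>T. w a) = (\<Sum>a\<in>T. act x (w a))"
  by (induction T rule: infinite_finite_induct) (simp_all add: act_add_right)

lemma act_bracket_swap: "act x (act y u) = act y (act x u) + act (bracket x y) u"
  by (simp add: act_bracket)

lemma gen_outside: "n < i \<Longrightarrow> gen (EGen i) = 0" "n < i \<Longrightarrow> gen (FGen i) = 0"
  using eval_relation[of "eT i" LZero] eval_relation[of "fT i" LZero]
  by (auto simp: affine_relations_def)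

lemma h_e: "j \<le> n \<Longrightarrow> h k (e j u) = e j (h k u) + vscale (simple_root n j k) (e j u)"
  using eval_relation[of "LBracket (hT k) (eT j)" "LScale (simple_root n j k) (eT j)"]
    act_bracket_swap[of "gen (HGen k)" "gen (EGen j)" u]
  by (auto simp: affine_relations_def act_scale_left)

lemma h_f: "j \<le> n \<Longrightarrow> h k (f j u) = f j (h k u) - vscale (simple_root n j k) (f j u)"
  using eval_relation[of "LBracket (hT k) (fT j)" "LScale (- simple_root n j k) (fT j)"]
    act_bracket_swap[of "gen (HGen k)" "gen (FGen j)" u]
  by (auto simp: affine_relations_def act_scale_left act_minus_left)

lemma e_f:
  assumes "i \<le> n" "j \<le> n"
  shows "e i (f j u) = f j (e i u) + (if i = j then h (Coroot i) u else 0)"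
proof (cases "i = j")
  case True
  have "(LBracket (eT i) (fT i), hT (Coroot i)) \<in> affine_relations n"
    using assms unfolding affine_relations_def by blast
  from eval_relation[OF this] show ?thesis
    using True act_bracket_swap[of "gen (EGen i)" "gen (FGen i)" u] by simp
next
  case False
  then have "(LBracket (eT i) (fT j), LZero) \<in> affine_relations n"
    using assms unfolding affine_relations_def by blast
  from eval_relation[OF this] show ?thesis
    using False act_bracket_swap[of "gen (EGen i)" "gen (FGen j)" u] by simp
qed

lemma wt_spaceD: "u \<in> wt_space \<mu> \<Longrightarrow> h k u = vscale (\<mu> k) u"
  by (simp add: weight_space_def)

lemma e_wt_space:
  assumes "u \<in> wt_space \<mu>" "i \<le> n"
  shows "e i u \<in> wt_space (\<lambda>k. \<mu> k + simple_root n i k)"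
  using assms by (simp add: weight_space_def h_e act_scale_right V.scale_left_distrib)

lemma f_wt_space:
  assumes "u \<in> wt_space \<mu>" "i \<le> n"
  shows "f i u \<in> wt_space (\<lambda>k. \<mu> k - simple_root n i k)"
  using assms by (simp add: weight_space_def h_f act_scale_right V.scale_left_diff_distrib)

section \<open>Monomials in the lowering operators span the module\<close>

definition fword :: "nat list \<Rightarrow> 'v" where
  "fword js = foldr f js v"

definition fwords :: "'v set" where
  "fwords = fword ` {js. set js \<subseteq> {..n}}"

lemma fword_weight:
  assumes "set js \<subseteq> {..n}"
  shows "\<exists>\<mu>\<in>weights_below n \<Lambda>. fword js \<in> wt_space \<mu>"
  using assms
proof (induction js)
  case Nil
  have "\<Lambda> \<in> weights_below n \<Lambda>"
    unfolding weights_below_def by (rule CollectI, rule exI[of _ "\<lambda>_. 0"]) (simp add: root_comb_def)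
  then show ?case
    using highest by (auto simp: fword_def highest_weight_vector_def)
next
  case (Cons j js)
  then obtain x where x: "\<forall>j\<le>n. 0 \<le> x j" "fword js \<in> wt_space (\<lambda>c. \<Lambda> c - root_comb n x c)"
    by (auto simp: weights_below_def)
  have "fword (j # js) \<in> wt_space (\<lambda>c. \<Lambda> c - root_comb n (x(j := x j + 1)) c)"
    using f_wt_space[OF x(2), of j] Cons.prems
    by (simp add: fword_def root_comb_update[of j n x 1] diff_diff_add)
  moreover have "(\<lambda>c. \<Lambda> c - root_comb n (x(j := x j + 1)) c) \<in> weights_below n \<Lambda>"
    by (rule weights_belowI) (use x(1) in auto)
  ultimately show ?case
    by blast
qed

lemma act_span:
  assumes "u \<in> V.span B" "\<And>b. b \<in> B \<Longrightarrow> act x b \<in> V.span C"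
  shows "act x u \<in> V.span C"
  using assms(1)
proof (induction rule: V.span_induct_alt)
  case base
  then show ?case by (simp add: V.span_zero)
next
  case (step c b u)
  then show ?case
    by (simp add: act_add_right act_scale_right V.span_add V.span_scale assms(2))
qed

lemma f_fwords_span: "u \<in> V.span fwords \<Longrightarrow> j \<le> n \<Longrightarrow> f j u \<in> V.span fwords"
proof (erule act_span)
  fix b assume "j \<le> n" "b \<in> fwords"
  then obtain js where "set (j # js) \<subseteq> {..n}" "f j b = fword (j # js)"
    by (auto simp: fwords_def fword_def)
  then show "f j b \<in> V.span fwords"
    by (metis (mono_tags, lifting) V.span_base fwords_def imageI mem_Collect_eq)
qed

text \<open>Moving \<open>e i\<close> to the right past each \<open>f j\<close> leaves at most a
  coroot term, which acts as a scalar on a monomial; finally \<open>e i\<close> kills the highest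
  weight vector.\<close>

lemma e_fword:
  assumes "set js \<subseteq> {..n}" "i \<le> n"
  shows "e i (fword js) \<in> V.span fwords"
  using assms(1)
proof (induction js)
  case Nil
  then show ?case
    using highest assms(2) by (simp add: fword_def highest_weight_vector_def V.span_zero)
next
  case (Cons j js)
  then obtain \<mu> where \<mu>: "fword js \<in> wt_space \<mu>"
    using fword_weight[of js] by auto
  have "fword js \<in> V.span fwords"
    using Cons.prems by (intro V.span_base) (auto simp: fwords_def)
  then have "h (Coroot i) (fword js) \<in> V.span fwords"
    by (simp add: wt_spaceD[OF \<mu>] V.span_scale)
  moreover have "fword (j # js) = f j (fword js)"
    by (simp add: fword_def)
  ultimately show ?case
    using Cons assms(2) by (auto simp: e_f V.span_add f_fwords_span)
qed

lemma gen_fwords_span: "u \<in> V.span fwords \<Longrightarrow> act (gen y) u \<in> V.span fwords"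
proof (erule act_span)
  fix b assume b: "b \<in> fwords"
  then obtain js where js: "b = fword js" "set js \<subseteq> {..n}"
    by (auto simp: fwords_def)
  show "act (gen y) b \<in> V.span fwords"
  proof (cases y)
    case (EGen i)
    then show ?thesis
      using e_fword[of js i] js gen_outside[of i] by (cases "i \<le> n") (auto simp: V.span_zero)
  next
    case (FGen i)
    then show ?thesis
      using f_fwords_span[of b i] V.span_base[OF b] gen_outside[of i]
      by (cases "i \<le> n") (auto simp: V.span_zero)
  next
    case (HGen k)
    obtain \<mu> where "b \<in> wt_space \<mu>"
      using fword_weight js by blast
    then show ?thesis
      using HGen V.span_base[OF b] by (simp add: wt_spaceD V.span_scale)
  qed
qed

text \<open>Induction over Lie terms reaches the whole algebra, because every element is the value
  of a term and brackets act as commutators.\<close>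

lemma eval_fwords_span:
  "u \<in> V.span fwords \<Longrightarrow> act (lie_eval scale bracket gen t) u \<in> V.span fwords"
  by (induction t arbitrary: u)
     (auto simp: gen_fwords_span act_add_left act_scale_left act_bracket
       V.span_zero V.span_add V.span_scale V.span_diff)

lemma span_fwords: "V.span fwords = UNIV"
proof -
  have "act x u \<in> V.span fwords" if "u \<in> V.span fwords" for x u
  proof -
    have "x \<in> range (lie_eval scale bracket gen)"
      using presented by (simp add: lie_algebra_presented_by_def)
    then show ?thesis
      using eval_fwords_span[OF that] by auto
  qed
  then have "lie_submodule vscale act (V.span fwords)"
    by (simp add: lie_submodule_def)
  moreover have "v \<in> V.span fwords"
    by (intro V.span_base) (auto simp: fwords_def fword_def intro!: image_eqI[of _ _ "[]"])
  ultimately show ?thesis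
    using highest by (simp add: highest_weight_vector_def)
qed

section \<open>All weights lie below the highest weight\<close>

lemma wt_space_scale: "u \<in> wt_space \<mu> \<Longrightarrow> vscale c u \<in> wt_space \<mu>"
  by (simp add: weight_space_def act_scale_right V.scale_left_commute)

text \<open>Applying \<open>h k\<close> minus the scalar \<open>\<nu> b k\<close> kills the summand
  at \<open>b\<close> and multiplies \<open>u\<close> by a nonzero number. The weights of the
  summands may repeat, as they do for monomials.\<close>

lemma wt_space_independent:
  assumes "finite T" "u \<in> wt_space \<mu>" "\<And>a. a \<in> T \<Longrightarrow> w a \<in> wt_space (\<nu> a)"
    and "\<And>a. a \<in> T \<Longrightarrow> \<nu> a \<noteq> \<mu>" and "u = (\<Sum>a\<in>T. w a)"
  shows "u = 0"
  using assms
proof (induction T arbitrary: u w rule: finite_induct)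
  case (insert b T)
  then obtain k where k: "\<nu> b k \<noteq> \<mu> k"
    by (metis ext insertI1)
  have hw: "h k (w a) = vscale (\<nu> a k) (w a)" if "a \<in> insert b T" for a
    using that by (intro wt_spaceD insert.prems)
  have "vscale (\<mu> k - \<nu> b k) u = h k u - vscale (\<nu> b k) u"
    using wt_spaceD[OF insert.prems(1)] by (simp add: V.scale_left_diff_distrib)
  also have "\<dots> = (\<Sum>a\<in>T. h k (w a)) - vscale (\<nu> b k) (\<Sum>a\<in>T. w a)"
    using insert.hyps hw[of b]
    by (simp add: insert.prems(4) act_add_right act_sum_right V.scale_right_distrib)
  also have "\<dots> = (\<Sum>a\<in>T. vscale (\<nu> a k - \<nu> b k) (w a))"
    by (simp add: V.scale_sum_right V.scale_left_diff_distrib sum_subtractf hw)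
  finally have eq: "vscale (\<mu> k - \<nu> b k) u = (\<Sum>a\<in>T. vscale (\<nu> a k - \<nu> b k) (w a))" .
  have "vscale (\<mu> k - \<nu> b k) u = 0"
    by (rule insert.IH[OF _ _ _ eq]) (simp_all add: insert.prems(1-3) wt_space_scale)
  then show ?case
    using k by simp
qed simp

lemma wts_below: "wts \<subseteq> weights_below n \<Lambda>"
proof
  fix \<mu> assume "\<mu> \<in> wts"
  then obtain u where u: "u \<in> wt_space \<mu>" "u \<noteq> 0"
    by (auto simp: module_weights_def)
  have "u \<in> V.span fwords"
    by (simp add: span_fwords)
  then obtain T r where T: "finite T" "T \<subseteq> fwords" "u = (\<Sum>a\<in>T. vscale (r a) a)"
    unfolding V.span_explicit by blast
  have "\<forall>a\<in>T. \<exists>\<nu>\<in>weights_below n \<Lambda>. a \<in> wt_space \<nu>"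
    using T(2) fword_weight by (auto simp: fwords_def)
  then obtain \<nu> where \<nu>: "\<And>a. a \<in> T \<Longrightarrow> \<nu> a \<in> weights_below n \<Lambda>" "\<And>a. a \<in> T \<Longrightarrow> a \<in> wt_space (\<nu> a)"
    by metis
  show "\<mu> \<in> weights_below n \<Lambda>"
  proof (rule ccontr)
    assume "\<mu> \<notin> weights_below n \<Lambda>"
    then have "u = 0"
      using T \<nu> u(1) by (intro wt_space_independent[of T u \<mu> "\<lambda>a. vscale (r a) a" \<nu>]) (auto intro: wt_space_scale)
    then show False
      using u(2) by simp
  qed
qed

lemma highest_weight: "\<Lambda> \<in> wts"
  using highest by (auto simp: highest_weight_vector_def module_weights_def)

section \<open>Strings of weights for the sl_2 attached to a node\<close>

lemma simple_root_self: "i \<le> n \<Longrightarrow> simple_root n i (Coroot i) = 2"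
  by (simp add: simple_root_def affine_cartan_def)

lemma e_power_wt_space:
  assumes "u \<in> wt_space \<mu>" "i \<le> n"
  shows "(e i ^^ k) u \<in> wt_space (\<lambda>c. \<mu> c + of_nat k * simple_root n i c)"
proof (induction k)
  case (Suc k)
  then show ?case
    using e_wt_space[OF Suc assms(2)] by (simp add: algebra_simps)
qed (simp add: assms)

text \<open>Each exchange of \<open>f i\<close> with \<open>e i\<close> subtracts a coroot term,
  whose eigenvalue grows by 2 along the string; the product formula sums this arithmetic
  progression.\<close>

lemma f_e_power:
  assumes "u \<in> wt_space \<mu>" "i \<le> n" "f i u = 0"
  shows "f i ((e i ^^ Suc k) u) =
    vscale (- (of_nat (Suc k) * (\<mu> (Coroot i) + of_nat k))) ((e i ^^ k) u)"
proof (induction k)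
  case 0
  have "e i (f i u) = f i (e i u) + h (Coroot i) u"
    using e_f[OF assms(2,2)] by simp
  then have "f i (e i u) = - h (Coroot i) u"
    using assms(3) by (simp add: eq_neg_iff_add_eq_0)
  then show ?case
    using wt_spaceD[OF assms(1)] by simp
next
  case (Suc k)
  let ?w = "(e i ^^ Suc k) u"
  have "e i (f i ?w) = f i (e i ?w) + h (Coroot i) ?w"
    using e_f[OF assms(2,2)] by simp
  then have "f i (e i ?w) = e i (f i ?w) - h (Coroot i) ?w"
    by simp
  also have "e i (f i ?w) = vscale (- (of_nat (Suc k) * (\<mu> (Coroot i) + of_nat k))) ?w"
    unfolding Suc.IH by (simp only: act_scale_right) simp
  also have "h (Coroot i) ?w = vscale (\<mu> (Coroot i) + of_nat (Suc k) * 2) ?w"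
    using wt_spaceD[OF e_power_wt_space[OF assms(1,2), of "Suc k"], of "Coroot i"]
    by (simp only: simple_root_self[OF assms(2)])
  finally have "f i (e i ?w) = vscale (- (of_nat (Suc k) * (\<mu> (Coroot i) + of_nat k))
      - (\<mu> (Coroot i) + of_nat (Suc k) * 2)) ?w"
    by (simp only: V.scale_left_diff_distrib)
  moreover have "- (of_nat (Suc k) * (\<mu> (Coroot i) + of_nat k)) - (\<mu> (Coroot i) + of_nat (Suc k) * 2)
      = - (of_nat (Suc (Suc k)) * (\<mu> (Coroot i) + of_nat (Suc k)))"
    by (simp add: algebra_simps)
  ultimately show ?case
    by simp
qed

lemma e_nilpotent:
  assumes "u \<in> wt_space \<mu>" "u \<noteq> 0" "i \<le> n"
  shows "\<exists>k. (e i ^^ k) u = 0"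
proof -
  have "\<mu> \<in> weights_below n \<Lambda>"
    using assms wts_below by (auto simp: module_weights_def)
  then obtain x where x: "\<mu> = (\<lambda>c. \<Lambda> c - root_comb n x c)" "0 \<le> x i"
    using assms(3) by (auto simp: weights_below_def)
  \<comment> \<open>One more than the multiplicity of the \<open>i\<close>-th simple root in
    \<Lambda> - \<mu>, so that raising \<open>k\<close> times would make this multiplicity
    negative.\<close>
  define k where "k = Suc (nat (x i))"
  have "(e i ^^ k) u = 0"
  proof (rule ccontr)
    assume "(e i ^^ k) u \<noteq> 0"
    then have "(\<lambda>c. \<mu> c + of_nat k * simple_root n i c) \<in> weights_below n \<Lambda>"
      using e_power_wt_space[OF assms(1,3), of k] wts_below by (auto simp: module_weights_def)
    then obtain y where y: "\<forall>j\<le>n. 0 \<le> y j"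
      "(\<lambda>c. \<mu> c + of_nat k * simple_root n i c) = (\<lambda>c. \<Lambda> c - root_comb n y c)"
      by (auto simp: weights_below_def)
    have "root_comb n (x(i := x i + (- int k))) c = root_comb n y c" for c
      using fun_cong[OF y(2), of c] unfolding root_comb_update[OF assms(3)] x(1)
      by (simp add: algebra_simps)
    then have "root_comb n (x(i := x i + (- int k))) = root_comb n y"
      by blast
    from root_comb_inject[OF rank_pos this assms(3)] have "x i - int k = y i"
      by simp
    then show False
      using x(2) y(1) assms(3) by (auto simp: k_def)
  qed
  then show ?thesis ..
qed

text \<open>If \<open>f i\<close> killed a weight vector \<open>u\<close>, the last nonzero vector
  of its \<open>e i\<close>-string would be annihilated by the scalar of \<open>f_e_power\<close>,
  which is nonzero because \<open>c > 0\<close>.\<close>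

lemma wts_diff_simple_root:
  assumes "\<mu> \<in> wts" "i \<le> n" "\<mu> (Coroot i) = of_nat c" "c > 0"
  shows "(\<lambda>k. \<mu> k - simple_root n i k) \<in> wts"
proof -
  obtain u where u: "u \<in> wt_space \<mu>" "u \<noteq> 0"
    using assms(1) by (auto simp: module_weights_def)
  have "f i u \<noteq> 0"
  proof
    assume f0: "f i u = 0"
    define k where "k = (LEAST k. (e i ^^ k) u = 0)"
    have k: "(e i ^^ k) u = 0"
      unfolding k_def using e_nilpotent[OF u assms(2)] by (rule LeastI_ex)
    with u(2) obtain k' where k': "k = Suc k'"
      by (cases k) auto
    have "(e i ^^ k') u \<noteq> 0"
      using not_less_Least[of k' "\<lambda>k. (e i ^^ k) u = 0"] k' k_def by simp
    moreover have "vscale (- (of_nat (Suc k') * (\<mu> (Coroot i) + of_nat k'))) ((e i ^^ k') u) = 0"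
      using f_e_power[OF u(1) assms(2) f0, of k'] k k' by simp
    moreover have "of_nat (Suc k') * (\<mu> (Coroot i) + of_nat k') \<noteq> 0"
      unfolding assms(3) of_nat_add[symmetric] of_nat_mult[symmetric] of_nat_eq_0_iff using assms(4) by simp
    ultimately show False
      by (metis V.scale_eq_0_iff neg_equal_0_iff_equal)
  qed
  then show ?thesis
    using f_wt_space[OF u(1) assms(2)] by (auto simp: module_weights_def)
qed

lemma null_root_Coroot: "i \<le> n \<Longrightarrow> null_root n (Coroot i) = 0"
proof -
  assume "i \<le> n"
  then have "null_root n (Coroot i) = of_int (cartan_apply n (\<lambda>_. 1) i)"
    by (simp add: null_root_def simple_root_def cartan_apply_def)
  also have "cartan_apply n (\<lambda>_. 1) i = 0"
    using cartan_apply_eq[OF rank_pos \<open>i \<le> n\<close>, of "\<lambda>_. 1"] by simp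
  finally show ?thesis
    by simp
qed

end

section \<open>Maximal dominant weights\<close>

text \<open>Weights are complex valued; this recovers the natural number when \<mu> is dominant
  integral.\<close>

definition coroot_value :: "weight \<Rightarrow> nat \<Rightarrow> nat" where
  "coroot_value \<mu> i = nat \<lfloor>Re (\<mu> (Coroot i))\<rfloor>"

lemma coroot_value:
  "dominant_integral n \<mu> \<Longrightarrow> i \<le> n \<Longrightarrow> \<mu> (Coroot i) = of_nat (coroot_value \<mu> i)"
  by (auto simp: dominant_integral_def coroot_value_def elim!: Nats_cases)

locale affine_dominant_module =
  affine_highest_weight_module scale bracket vscale act n gen \<Lambda> v
  for scale :: "complex \<Rightarrow> 'g::ab_group_add \<Rightarrow> 'g" and bracket :: "'g \<Rightarrow> 'g \<Rightarrow> 'g"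
    and vscale :: "complex \<Rightarrow> 'v::ab_group_add \<Rightarrow> 'v" and act :: "'g \<Rightarrow> 'v \<Rightarrow> 'v"
    and n gen \<Lambda> v +
  fixes m :: "nat \<Rightarrow> nat"
  assumes coroot: "\<And>i. i \<le> n \<Longrightarrow> \<Lambda> (Coroot i) = of_nat (m i)"
    and level_pos: "(\<Sum>i\<le>n. m i) > 0"
begin

section \<open>Dominant elements below the highest weight are weights\<close>

lemma coroot_value_below:
  assumes "dominant_integral n \<mu>" "\<mu> = (\<lambda>c. \<Lambda> c - root_comb n x c)" "i \<le> n"
  shows "int (coroot_value \<mu> i) = int (m i) - cartan_apply n x i"
proof -
  have "(of_int (int (coroot_value \<mu> i)) :: complex) = of_int (int (m i) - cartan_apply n x i)"
    using coroot_value[OF assms(1,3)] assms(2,3) by (simp add: coroot root_comb_Coroot)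
  then show ?thesis
    by (simp only: of_int_eq_iff)
qed

lemma dominant_below_in_wts:
  assumes "\<mu> \<in> weights_below n \<Lambda>" "dominant_integral n \<mu>"
  shows "\<mu> \<in> wts"
proof -
  obtain x where x: "\<forall>j\<le>n. 0 \<le> x j" "\<mu> = (\<lambda>c. \<Lambda> c - root_comb n x c)"
    using assms(1) by (auto simp: weights_below_def)
  let ?a = "\<lambda>i. int (coroot_value \<mu> i)"
  have a: "?a i = int (m i) - cartan_apply n x i" if "i \<le> n" for i
    using coroot_value_below[OF assms(2) x(2) that] .
  have "(\<Sum>i\<le>n. ?a i) = int (\<Sum>i\<le>n. m i)"
    using sum_cartan_apply[OF rank_pos, of x] by (simp add: a sum_subtractf)
  then have a_pos: "(\<Sum>i\<le>n. ?a i) > 0"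
    using level_pos by linarith
  \<comment> \<open>\<open>y\<close> records what has been subtracted from \<Lambda> so far; the
    induction is on the total that remains in \<open>x - y\<close>.\<close>
  have "\<mu> \<in> wts" if "\<forall>j\<le>n. y j \<le> x j" "(\<lambda>c. \<Lambda> c - root_comb n y c) \<in> wts" for y
    using that
  proof (induction "nat (\<Sum>j\<le>n. x j - y j)" arbitrary: y rule: less_induct)
    case less
    show ?case
    proof (cases "\<exists>j\<le>n. x j - y j > 0")
      case False
      then have "root_comb n y = root_comb n x"
        using less.prems(1) by (intro root_comb_cong) force
      then show ?thesis
        using less.prems(2) x(2) by simp
    next
      case True
      then obtain i where i: "i \<le> n" "x i - y i > 0"
        "?a i + cartan_apply n (\<lambda>j. x j - y j) i > 0"
        using exists_positive_coroot[OF rank_pos, of "\<lambda>j. x j - y j" _ ?a] less.prems(1) a_pos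
        by (metis diff_ge_0_iff_ge of_nat_0_le_iff)
      let ?\<nu> = "\<lambda>c. \<Lambda> c - root_comb n y c" and ?z = "y(i := y i + 1)"
      \<comment> \<open>Since \<open>?a\<close> is \<open>m\<close> minus the Cartan image of
        \<open>x\<close>, adding the image of \<open>x - y\<close> gives the coroot values of the
        weight currently reached.\<close>
      have pos: "int (m i) - cartan_apply n y i > 0"
        using i(3) a[OF i(1)] by (simp add: cartan_apply_diff)
      have "?\<nu> (Coroot i) = of_int (int (m i) - cartan_apply n y i)"
        using i(1) by (simp add: coroot root_comb_Coroot)
      also have "\<dots> = of_nat (nat (int (m i) - cartan_apply n y i))"
        using pos by (metis less_imp_le nat_0_le of_int_of_nat_eq)
      finally have "(\<lambda>k. ?\<nu> k - simple_root n i k) \<in> wts"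
        using wts_diff_simple_root[OF less.prems(2) i(1)] pos by (metis zero_less_nat_eq)
      then have z: "(\<lambda>c. \<Lambda> c - root_comb n ?z c) \<in> wts"
        by (simp add: root_comb_update[OF i(1), of y 1] diff_diff_add)
      have "(\<Sum>j\<le>n. x j - ?z j) < (\<Sum>j\<le>n. x j - y j)"
        using i by (intro sum_strict_mono_ex1) auto
      moreover have "(\<Sum>j\<le>n. x j - ?z j) \<ge> 0"
        using less.prems(1) i(2) by (intro sum_nonneg) auto
      ultimately have "nat (\<Sum>j\<le>n. x j - ?z j) < nat (\<Sum>j\<le>n. x j - y j)"
        by linarith
      then show ?thesis
        using z less.prems(1) i(2) by (intro less.hyps) auto
    qed
  qed
  from this[of "\<lambda>_. 0"] show ?thesis
    using x(1) highest_weight by (simp add: root_comb_def)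
qed

lemma dominant_wts_iff: "dominant_integral n \<mu> \<Longrightarrow> \<mu> \<in> wts \<longleftrightarrow> \<mu> \<in> weights_below n \<Lambda>"
  using dominant_below_in_wts wts_below by blast

lemma dominant_add_null_root:
  "dominant_integral n \<mu> \<Longrightarrow> dominant_integral n (\<lambda>k. \<mu> k + null_root n k)"
  by (simp add: dominant_integral_def null_root_Coroot)

section \<open>Maximality in terms of coefficients\<close>

abbreviation "max_wts \<equiv> max_dominant_weights n gen vscale act"

text \<open>If all coefficients were positive, lowering each by 1 would add the null root and stay
  below \<Lambda>.\<close>

lemma max_wtsD:
  assumes "\<mu> \<in> max_wts"
  obtains x where "dominant_integral n \<mu>" "\<forall>j\<le>n. 0 \<le> x j"
    "\<mu> = (\<lambda>c. \<Lambda> c - root_comb n x c)" "\<exists>j\<le>n. x j = 0"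
proof -
  have \<mu>: "dominant_integral n \<mu>" "\<mu> \<in> weights_below n \<Lambda>"
    "(\<lambda>k. \<mu> k + null_root n k) \<notin> weights_below n \<Lambda>"
    using assms dominant_wts_iff dominant_add_null_root by (auto simp: max_dominant_weights_def)
  then obtain x where x: "\<forall>j\<le>n. 0 \<le> x j" "\<mu> = (\<lambda>c. \<Lambda> c - root_comb n x c)"
    by (auto simp: weights_below_def)
  have "\<exists>j\<le>n. x j = 0"
  proof (rule ccontr)
    assume "\<not> ?thesis"
    then have "\<forall>j\<le>n. 0 \<le> x j + (-1)"
      using x(1) by force
    then have "(\<lambda>c. \<Lambda> c - root_comb n (\<lambda>j. x j + (-1)) c) \<in> weights_below n \<Lambda>"
      by (rule weights_belowI)
    moreover have "\<Lambda> c - root_comb n (\<lambda>j. x j + (-1)) c = \<mu> c + null_root n c" for c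
      using root_comb_add_const[of n x "-1" c] by (simp add: x(2))
    ultimately show False
      using \<mu>(3) by simp
  qed
  then show ?thesis
    using that \<mu>(1) x by blast
qed

text \<open>Coefficients are unique by \<open>root_comb_inject\<close>, so adding the null root
  gives the coefficient -1 at the node where \<open>x\<close> is 0.\<close>

lemma max_wtsI:
  assumes "dominant_integral n \<mu>" "\<forall>j\<le>n. 0 \<le> x j" "\<mu> = (\<lambda>c. \<Lambda> c - root_comb n x c)"
    and "i \<le> n" "x i = 0"
  shows "\<mu> \<in> max_wts"
proof -
  have "(\<lambda>k. \<mu> k + null_root n k) \<notin> weights_below n \<Lambda>"
  proof
    assume "(\<lambda>k. \<mu> k + null_root n k) \<in> weights_below n \<Lambda>"
    then obtain y where y: "\<forall>j\<le>n. 0 \<le> y j"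
      "(\<lambda>k. \<mu> k + null_root n k) = (\<lambda>c. \<Lambda> c - root_comb n y c)"
      by (auto simp: weights_below_def)
    have "root_comb n (\<lambda>j. x j + (-1)) c = root_comb n y c" for c
      using fun_cong[OF y(2), of c] root_comb_add_const[of n x "-1" c] by (simp add: assms(3) algebra_simps) (metis add_left_cancel)
    then have "root_comb n (\<lambda>j. x j + (-1)) = root_comb n y"
      by blast
    from root_comb_inject[OF rank_pos this assms(4)] show False
      using y(1) assms(4,5) by force
  qed
  moreover have "\<mu> \<in> weights_below n \<Lambda>"
    unfolding assms(3) by (rule weights_belowI[OF assms(2)])
  ultimately show ?thesis
    using assms(1) dominant_wts_iff dominant_add_null_root by (auto simp: max_dominant_weights_def)
qed

section \<open>Coroot coordinates of maximal dominant weights\<close>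

definition coords :: "weight \<Rightarrow> nat list" where
  "coords \<mu> = map (coroot_value \<mu>) [0..<Suc n]"

lemma coords_in_compositions:
  assumes "\<mu> \<in> max_wts"
  shows "coords \<mu> \<in> compositions (Suc n) (\<Sum>i\<le>n. m i) (Suc n) (\<Sum>i\<le>n. i * m i)"
proof -
  obtain x where x: "dominant_integral n \<mu>" "\<mu> = (\<lambda>c. \<Lambda> c - root_comb n x c)"
    using assms by (rule max_wtsD)
  have a: "int (coroot_value \<mu> i) = int (m i) - cartan_apply n x i" if "i \<le> n" for i
    using coroot_value_below[OF x that] .
  have "int (\<Sum>i\<le>n. coroot_value \<mu> i) = int (\<Sum>i\<le>n. m i)"
    using sum_cartan_apply[OF rank_pos, of x] by (simp add: a sum_subtractf)
  then have "sum_list (coords \<mu>) = (\<Sum>i\<le>n. m i)"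
    unfolding coords_def interv_sum_list_conv_sum_set_nat of_nat_eq_iff
    by (simp only: atLeast_upt[symmetric] lessThan_atLeast0[symmetric] lessThan_Suc_atMost set_upt)
  moreover have "[weighted_sum (coords \<mu>) = (\<Sum>i\<le>n. i * m i)] (mod Suc n)"
  proof -
    have "int (\<Sum>i\<le>n. i * coroot_value \<mu> i) - int (\<Sum>i\<le>n. i * m i) =
        - (\<Sum>i\<le>n. int i * cartan_apply n x i)"
      by (simp add: a right_diff_distrib sum_subtractf)
    then have "int (Suc n) dvd int (\<Sum>i\<le>n. i * coroot_value \<mu> i) - int (\<Sum>i\<le>n. i * m i)"
      using weighted_sum_cartan_apply[OF rank_pos, of x] by (simp add: add.commute)
    then show ?thesis
      unfolding coords_def weighted_sum_eq lessThan_Suc_atMost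
      by (simp only: cong_int_iff[symmetric] cong_iff_dvd_diff)
  qed
  ultimately show ?thesis
    by (simp add: compositions_def coords_def)
qed

text \<open>Equal coordinates leave only a multiple of the null root as difference. Both coefficient
  functions are nonnegative and have a zero, so this multiple is 0.\<close>

lemma inj_on_coords: "inj_on coords max_wts"
proof (rule inj_onI)
  fix \<mu> \<nu> assume \<mu>\<nu>: "\<mu> \<in> max_wts" "\<nu> \<in> max_wts" "coords \<mu> = coords \<nu>"
  obtain x where x: "dominant_integral n \<mu>" "\<forall>j\<le>n. 0 \<le> x j"
    "\<mu> = (\<lambda>c. \<Lambda> c - root_comb n x c)" "\<exists>j\<le>n. x j = 0"
    using \<mu>\<nu>(1) by (rule max_wtsD)
  obtain y where y: "dominant_integral n \<nu>" "\<forall>j\<le>n. 0 \<le> y j"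
    "\<nu> = (\<lambda>c. \<Lambda> c - root_comb n y c)" "\<exists>j\<le>n. y j = 0"
    using \<mu>\<nu>(2) by (rule max_wtsD)
  have "cartan_apply n (\<lambda>j. x j - y j) i = 0" if "i \<le> n" for i
  proof -
    have "coroot_value \<mu> i = coroot_value \<nu> i"
      using \<mu>\<nu>(3) that by (simp add: coords_def del: upt_Suc)
    then show ?thesis
      using coroot_value_below[OF x(1,3) that] coroot_value_below[OF y(1,3) that]
      by (simp add: cartan_apply_diff)
  qed
  then have const: "x i - y i = x 0 - y 0" if "i \<le> n" for i
    using cartan_kernel[OF rank_pos _ that, of "\<lambda>j. x j - y j"] by blast
  obtain i j where "i \<le> n" "x i = 0" "j \<le> n" "y j = 0"
    using x(4) y(4) by blast
  then have "x 0 = y 0"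
    using const[of i] const[of j] x(2) y(2) by force
  then have "root_comb n x = root_comb n y"
    using const by (intro root_comb_cong) force
  then show "\<mu> = \<nu>"
    by (simp add: x(3) y(3))
qed

lemma coords_surj:
  assumes "fs \<in> compositions (Suc n) (\<Sum>i\<le>n. m i) (Suc n) (\<Sum>i\<le>n. i * m i)"
  shows "fs \<in> coords ` max_wts"
proof -
  define b where "b i = int (m i) - int (fs ! i)" for i
  have fs: "fs = map (\<lambda>i. fs ! i) [0..<Suc n]"
    using assms by (intro nth_equalityI) (auto simp: compositions_def simp del: upt_Suc)
  have "sum_list fs = (\<Sum>i\<le>n. fs ! i)"
    using assms by (simp add: sum_list_sum_nth compositions_def atLeast0LessThan lessThan_Suc_atMost)
  then have "int (\<Sum>i\<le>n. fs ! i) = int (\<Sum>i\<le>n. m i)"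
    using assms by (simp add: compositions_def)
  then have sum: "(\<Sum>i\<le>n. b i) = 0"
    by (simp add: b_def sum_subtractf)
  have "weighted_sum fs = (\<Sum>i\<le>n. i * fs ! i)"
    by (subst fs) (simp only: weighted_sum_eq lessThan_Suc_atMost)
  then have "int (Suc n) dvd int (\<Sum>i\<le>n. i * m i) - int (\<Sum>i\<le>n. i * fs ! i)"
    using assms by (metis (mono_tags, lifting) compositions_def cong_iff_dvd_diff cong_int_iff cong_sym mem_Collect_eq)
  then have "(int n + 1) dvd (\<Sum>i\<le>n. int i * b i)"
    by (simp add: b_def right_diff_distrib sum_subtractf add.commute)
  then obtain z where z: "\<And>i. i \<le> n \<Longrightarrow> cartan_apply n z i = b i"
    using cartan_solve[OF rank_pos sum] by blast
  \<comment> \<open>Subtracting the minimum leaves the Cartan image unchanged and makes the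
    coefficients nonnegative with a zero, which is what maximality requires.\<close>
  have "Min (z ` {..n}) \<in> z ` {..n}"
    by (intro Min_in) auto
  then obtain i where i: "i \<le> n" "z i = Min (z ` {..n})"
    by (metis atMost_iff imageE)
  define x where "x j = z j - z i" for j
  have x: "\<forall>j\<le>n. 0 \<le> x j" "x i = 0"
    by (auto simp: x_def i(2))
  have xb: "cartan_apply n x j = b j" if "j \<le> n" for j
    using cartan_apply_eq[OF rank_pos that] z[OF that] by (simp add: x_def)
  define \<mu> where "\<mu> = (\<lambda>c. \<Lambda> c - root_comb n x c)"
  have "\<mu> (Coroot j) = of_nat (fs ! j)" if "j \<le> n" for j
    using that xb[OF that] by (simp add: \<mu>_def root_comb_Coroot coroot b_def)
  then have dom: "dominant_integral n \<mu>" and "\<forall>j\<le>n. coroot_value \<mu> j = fs ! j"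
    by (auto simp: dominant_integral_def coroot_value_def)
  then have "coords \<mu> = fs"
    by (subst fs) (auto simp: coords_def simp del: upt_Suc)
  moreover have "\<mu> \<in> max_wts"
    using max_wtsI[OF dom x(1) \<mu>_def i(1) x(2)] .
  ultimately show ?thesis
    by blast
qed

theorem max_wts_eqpoll:
  "max_wts \<approx> compositions (Suc n) (\<Sum>i\<le>n. m i) (Suc n) (\<Sum>i\<le>n. i * m i)"
  unfolding eqpoll_def bij_betw_def
  using inj_on_coords coords_in_compositions coords_surj by blast

end

section \<open>Application to the two modules\<close>

lemma irreducible_module_max_weights:
  assumes "irreducible_highest_weight_module_A n scale bracket gen \<Lambda> vscale act" "n \<ge> 1"
    and "\<And>i. i \<le> n \<Longrightarrow> \<Lambda> (Coroot i) = of_nat (m i)" "(\<Sum>i\<le>n. m i) > 0"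
  shows "max_dominant_weights n gen vscale act
    \<approx> compositions (Suc n) (\<Sum>i\<le>n. m i) (Suc n) (\<Sum>i\<le>n. i * m i)"
proof -
  obtain v where "highest_weight_vector n gen vscale act \<Lambda> v"
    using assms(1) by (auto simp: irreducible_highest_weight_module_A_def)
  with assms interpret affine_dominant_module scale bracket vscale act n gen \<Lambda> v m
    by (auto simp: affine_dominant_module_def affine_dominant_module_axioms_def
        affine_highest_weight_module_def affine_highest_weight_module_axioms_def
        irreducible_highest_weight_module_A_def affine_algebra_A_def)
  show ?thesis
    by (rule max_wts_eqpoll)
qed

lemma fundamental_combination_Coroot:
  assumes "i \<le> n"
  shows "(\<Sum>j=0..n. of_nat (m j) * fundamental_weight n j (Coroot i)) = of_nat (m i)"
proof -
  have "(\<Sum>j=0..n. of_nat (m j) * fundamental_weight n j (Coroot i)) =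
      (\<Sum>j=0..n. if j = i then of_nat (m j) else 0 :: complex)"
    by (rule sum.cong) (auto simp: fundamental_weight_def)
  then show ?thesis
    using assms by simp
qed

text \<open>Regrouping by residue: it computes the level and the weighted sum for a weight given as
  a sum of fundamental weights with repeated indices.\<close>

lemma sum_residue_counts:
  fixes g s :: "nat \<Rightarrow> nat"
  assumes "l > 0"
  shows "(\<Sum>i\<le>l - 1. g i * (\<Sum>j=0..n. if s j mod l = i then 1 else 0)) = (\<Sum>j=0..n. g (s j mod l))"
proof -
  have "(\<Sum>i\<le>l - 1. g i * (\<Sum>j=0..n. if s j mod l = i then 1 else 0)) =
      (\<Sum>j=0..n. \<Sum>i\<le>l - 1. if s j mod l = i then g i else 0)"
    unfolding sum_distrib_left by (subst sum.swap) (intro sum.cong, auto)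
  also have "\<dots> = (\<Sum>j=0..n. g (s j mod l))"
  proof (rule sum.cong)
    fix j
    have "s j mod l < l"
      using assms by simp
    then have "s j mod l \<le> l - 1"
      by linarith
    then show "(\<Sum>i\<le>l - 1. if s j mod l = i then g i else 0) = g (s j mod l)"
      by simp
  qed simp
  finally show ?thesis .
qed

text \<open>The entry \<open>m j\<close> occurs in the tails starting at 0, ..., \<open>j\<close>,
  hence \<open>Suc j\<close> times.\<close>

lemma sum_tails: "(\<Sum>i=0..n. \<Sum>j=i..n. m j) = (\<Sum>j=0..n. Suc j * m j)" for m :: "nat \<Rightarrow> nat"
proof (induction n)
  case (Suc n)
  have "(\<Sum>i=0..Suc n. \<Sum>j=i..Suc n. m j) = (\<Sum>i=0..n. (\<Sum>j=i..n. m j) + m (Suc n)) + m (Suc n)"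
    by simp
  then show ?case
    using Suc by (simp only: sum.distrib) simp
qed simp

theorem mainTheorem12:
  fixes n l :: nat and m :: "nat \<Rightarrow> nat"
    and \<Lambda> \<Lambda>' :: weight
    and scale\<^sub>1 :: "complex \<Rightarrow> 'g::ab_group_add \<Rightarrow> 'g"
    and bracket\<^sub>1 :: "'g \<Rightarrow> 'g \<Rightarrow> 'g"
    and gen\<^sub>1 :: "km_generator \<Rightarrow> 'g"
    and vscale\<^sub>1 :: "complex \<Rightarrow> 'v::ab_group_add \<Rightarrow> 'v"
    and act\<^sub>1 :: "'g \<Rightarrow> 'v \<Rightarrow> 'v"
    and scale\<^sub>2 :: "complex \<Rightarrow> 'h::ab_group_add \<Rightarrow> 'h"
    and bracket\<^sub>2 :: "'h \<Rightarrow> 'h \<Rightarrow> 'h"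
    and gen\<^sub>2 :: "km_generator \<Rightarrow> 'h"
    and vscale\<^sub>2 :: "complex \<Rightarrow> 'w::ab_group_add \<Rightarrow> 'w"
    and act\<^sub>2 :: "'h \<Rightarrow> 'w \<Rightarrow> 'w"
  assumes "n \<ge> 1" and "l \<ge> 2"
    and "(\<Sum>i=0..n. m i) = l"
    and "\<Lambda> = (\<lambda>k. \<Sum>i=0..n. of_nat (m i) * fundamental_weight n i k)"
    and "\<Lambda>' = (\<lambda>k. \<Sum>i=0..n. fundamental_weight (l - 1) (\<Sum>j=i..n. m j) k)"
    and "irreducible_highest_weight_module_A n scale\<^sub>1 bracket\<^sub>1 gen\<^sub>1 \<Lambda> vscale\<^sub>1 act\<^sub>1"
    and "irreducible_highest_weight_module_A (l - 1) scale\<^sub>2 bracket\<^sub>2 gen\<^sub>2 \<Lambda>' vscale\<^sub>2 act\<^sub>2"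
  shows "max_dominant_weights n gen\<^sub>1 vscale\<^sub>1 act\<^sub>1
           \<approx> max_dominant_weights (l - 1) gen\<^sub>2 vscale\<^sub>2 act\<^sub>2"
proof -
  define c where "c = (\<Sum>i\<le>n. i * m i)"
  define s where "s i = (\<Sum>j=i..n. m j)" for i
  \<comment> \<open>The multiplicity of the \<open>i\<close>-th fundamental weight in
    \<open>\<Lambda>'\<close>, the indices being reduced modulo \<open>l\<close>.\<close>
  define m' where "m' i = (\<Sum>j=0..n. if s j mod l = i then 1 else 0 :: nat)" for i
  have m_sum: "(\<Sum>i\<le>n. m i) = l"
    using assms(3) by (simp add: atLeast0AtMost)
  have l: "Suc (l - 1) = l"
    using assms(2) by simp
  have first: "max_dominant_weights n gen\<^sub>1 vscale\<^sub>1 act\<^sub>1 \<approx> compositions (Suc n) l (Suc n) c"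
    using irreducible_module_max_weights[OF assms(6,1), of m] assms(2)
    by (simp add: assms(4) fundamental_combination_Coroot m_sum c_def)
  have coroot': "\<Lambda>' (Coroot i) = of_nat (m' i)" if "i \<le> l - 1" for i
    unfolding assms(5) m'_def s_def of_nat_sum
    by (rule sum.cong) (use assms(2) in \<open>auto simp: fundamental_weight_def\<close>)
  have m'_sum: "(\<Sum>i\<le>l - 1. m' i) = Suc n"
    using sum_residue_counts[where l = l and g = "\<lambda>_. 1" and n = n and s = s] assms(2) by (simp add: m'_def)
  \<comment> \<open>The surplus \<open>l\<close> disappears modulo \<open>l\<close>, so both modules
    are described by the same residue \<open>c\<close>.\<close>
  have "(\<Sum>i=0..n. s i) = c + l"
    unfolding s_def sum_tails by (simp add: c_def m_sum sum.distrib atLeast0AtMost)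
  moreover have "(\<Sum>i\<le>l - 1. i * m' i) = (\<Sum>j=0..n. s j mod l)"
    using sum_residue_counts[where l = l and g = "\<lambda>i. i" and n = n and s = s] assms(2) by (simp add: m'_def)
  ultimately have "[(\<Sum>i\<le>l - 1. i * m' i) = c] (mod l)"
    by (simp add: cong_def mod_sum_eq)
  then have "compositions l (Suc n) l (\<Sum>i\<le>l - 1. i * m' i) = compositions l (Suc n) l c"
    by (simp add: compositions_def cong_def)
  moreover have "l - 1 \<ge> 1" "(\<Sum>i\<le>l - 1. m' i) > 0"
    using assms(2) by (simp, simp only: m'_sum)
  ultimately have second:
    "max_dominant_weights (l - 1) gen\<^sub>2 vscale\<^sub>2 act\<^sub>2 \<approx> compositions l (Suc n) l c"
    using irreducible_module_max_weights[OF assms(7) _ coroot'] by (simp only: m'_sum l)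
  \<comment> \<open>The duality exchanges the number of coordinates \<open>Suc n\<close> with the
    level \<open>l\<close>.\<close>
  have "compositions (Suc n) l (Suc n) c \<approx> compositions l (Suc n) l c"
    using card_compositions_swap[of "Suc n" l c] assms(2)
    by (simp add: eqpoll_iff_card finite_compositions)
  then show ?thesis
    using first second by (meson eqpoll_sym eqpoll_trans)
qed

end
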